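(* Let $q\ge 0$ be an integer and let $G$ and $H$ be groups. If $G$ and $H$ are $q$-isoclinic, then $B_0^q(G)\cong B_0^q(H)$. If $G$ and $H$ are $\widehat{q}$-isoclinic, then $\widehat{B_0^q(G)}\cong\widehat{B_0^q(H)}$.
   Context: Notation: ${}^g h=ghg^{-1}$ and $[g,h]=ghg^{-1}h^{-1}$; $G^q[G,G]$ is the subgroup of $G$ generated by all $q$-th powers and all commutators (for $q=0$ it is $[G,G]$). For $q\geq 1$, the $q$-tensor square $G\otimes^q G$ is the group generated by symbols $g\otimes h$ and $\{(g,g)\}$ ($g,h\in G$) subject to the following relations for all $g,h,g_1,h_1\in G$: (1) $gg_1\otimes h=({}^g g_1\otimes {}^g h)(g\otimes h)$; (2) $g\otimes hh_1=(g\otimes h)({}^h g\otimes {}^h h_1)$; (3) $\{(g,g)\}(g_1\otimes h_1)\{(g,g)\}^{-1}={}^{g^q}g_1\otimes {}^{g^q}h_1$; (4) $\{(gg_1,gg_1)\}=\{(g,g)\}\prod_{i=1}^{q-1}\big(g^{-1}\otimes({}^{g^{1-q+i}}g_1)^i\big)\{(g_1,g_1)\}$ (product in increasing order of $i$); (5) $[\{(g,g)\},\{(g_1,g_1)\}]=g^q\otimes g_1^q$; (6) $\{([g,h],[g,h])\}=(g\otimes h)^q$. For $q=0$, $G\otimes^0 G$ is the nonabelian tensor square of Brown and Loday: generators $g\otimes h$ only, subject to relations (1) and (2). The $q$-exterior square $G\wedge^q G$ is the quotient of $G\otimes^q G$ by the normal subgroup generated by all $g\otimes g$, $g\in G$;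 the image of $g\otimes h$ is written $g\wedge h$, and the image of $\{(g,g)\}$ is again written $\{(g,g)\}$. There is a homomorphism $\eta:G\wedge^q G\to G$ with $x\wedge y\mapsto [x,y]$ and (for $q\ge1$) $\{(g,g)\}\mapsto g^q$; its kernel is the $q$-Schur multiplier $M^q(G)$. Define the following normal subgroups of $G\wedge^q G$ contained in $M^q(G)$, and the corresponding quotients: $M_0^q(G)=\langle x\wedge y : [x,y]=1\rangle$, $B_0^q(G)=M^q(G)/M_0^q(G)$ (the $q$-Bogomolov multiplier); $\widehat{M_0^q(G)}=\langle x\wedge y,\ \{(g,g)\} : [x,y]=1,\ g^q=1\rangle$, $\widehat{B_0^q(G)}=M^q(G)/\widehat{M_0^q(G)}$ (the $\widehat q$-Bogomolov multiplier). Define the normal subgroups of $G$: $Z_q(G)=\{g\in Z(G): \{(g,g)\}\in M_0^q(G)\}$ and $\widehat{Z_q(G)}=\{g\in Z(G): g^q=1\}$. For $q=0$, generators and conditions involving $\{(g,g)\}$ are omitted, so $Z_0(G)=\widehat{Z_0(G)}=Z(G)$ and $M_0^0(G)=\widehat{M_0^0(G)}$. $G$ and $H$ are $q$-isoclinic if there exist isomorphisms $\alpha:G/Z_q(G)\to H/Z_q(H)$ and $\beta:G^q[G,G]\to H^q[H,H]$ such that whenever $\alpha(a_1Z_q(G))=a_2Z_q(H)$ and $\alpha(b_1Z_q(G))=b_2Z_q(H)$ (with $a_1,b_1\in G$, $a_2,b_2\in H$), one has $\beta([a_1,b_1])=[a_2,b_2]$ and $\beta(a_1^q)=a_2^q$.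 $G$ and $H$ are $\widehat q$-isoclinic if the same condition holds with $Z_q(\cdot)$ replaced by $\widehat{Z_q(\cdot)}$ throughout. *)

theory Defs
  imports "HOL-Algebra.Algebra"
begin

subsection \<open>Group presentations\<close>

text \<open>A word over a set \<open>S\<close> of generators is a list of letters \<open>(x, b)\<close>, where \<open>(x, True)\<close> stands
  for \<open>x\<close> and \<open>(x, False)\<close> for its formal inverse. A relation \<open>r = s\<close> is the pair \<open>(r, s)\<close>.\<close>

type_synonym 'g word = "('g \<times> bool) list"

definition words :: "'g set \<Rightarrow> 'g word set" where
  "words S = {w. fst ` set w \<subseteq> S}"

definition word_inv :: "'g word \<Rightarrow> 'g word" where
  "word_inv w = rev (map (\<lambda>(x, b). (x, \<not> b)) w)"

inductive word_eq :: "'g set \<Rightarrow> ('g word \<times> 'g word) set \<Rightarrow> 'g word \<Rightarrow> 'g word \<Rightarrow> bool"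
  for S R where
  refl: "w \<in> words S \<Longrightarrow> word_eq S R w w"
| sym: "word_eq S R v w \<Longrightarrow> word_eq S R w v"
| trans: "word_eq S R u v \<Longrightarrow> word_eq S R v w \<Longrightarrow> word_eq S R u w"
| cancel: "u \<in> words S \<Longrightarrow> v \<in> words S \<Longrightarrow> x \<in> S \<Longrightarrow>
    word_eq S R (u @ [(x, b), (x, \<not> b)] @ v) (u @ v)"
| rel: "(r, s) \<in> R \<Longrightarrow> r \<in> words S \<Longrightarrow> s \<in> words S \<Longrightarrow> u \<in> words S \<Longrightarrow> v \<in> words S \<Longrightarrow>
    word_eq S R (u @ r @ v) (u @ s @ v)"

definition word_class :: "'g set \<Rightarrow> ('g word \<times> 'g word) set \<Rightarrow> 'g word \<Rightarrow> 'g word set" where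
  "word_class S R w = {v. word_eq S R w v}"

definition presented_group :: "'g set \<Rightarrow> ('g word \<times> 'g word) set \<Rightarrow> 'g word set monoid" where
  "presented_group S R =
    \<lparr>carrier = word_class S R ` words S,
     monoid.mult = (\<lambda>A B. {w. \<exists>u\<in>A. \<exists>v\<in>B. word_eq S R (u @ v) w}),
     one = word_class S R []\<rparr>"

text \<open>The value of a word under an assignment of group elements to the generators.\<close>

definition word_val :: "('a, 'b) monoid_scheme \<Rightarrow> ('g \<Rightarrow> 'a) \<Rightarrow> 'g word \<Rightarrow> 'a" where
  "word_val G f w =
    foldr (\<lambda>(x, b) y. (if b then f x else inv\<^bsub>G\<^esub> (f x)) \<otimes>\<^bsub>G\<^esub> y) w \<one>\<^bsub>G\<^esub>"

subsection \<open>Group-theoretic notation\<close>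

definition conj_by :: "('a, 'b) monoid_scheme \<Rightarrow> 'a \<Rightarrow> 'a \<Rightarrow> 'a" where
  "conj_by G g h = g \<otimes>\<^bsub>G\<^esub> h \<otimes>\<^bsub>G\<^esub> inv\<^bsub>G\<^esub> g"

definition commutator :: "('a, 'b) monoid_scheme \<Rightarrow> 'a \<Rightarrow> 'a \<Rightarrow> 'a" where
  "commutator G g h = g \<otimes>\<^bsub>G\<^esub> h \<otimes>\<^bsub>G\<^esub> inv\<^bsub>G\<^esub> g \<otimes>\<^bsub>G\<^esub> inv\<^bsub>G\<^esub> h"

definition normal_closure :: "('a, 'b) monoid_scheme \<Rightarrow> 'a set \<Rightarrow> 'a set" where
  "normal_closure G S = generate G {conj_by G g s | g s. g \<in> carrier G \<and> s \<in> S}"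

definition center :: "('a, 'b) monoid_scheme \<Rightarrow> 'a set" where
  "center G = {z \<in> carrier G. \<forall>g\<in>carrier G. z \<otimes>\<^bsub>G\<^esub> g = g \<otimes>\<^bsub>G\<^esub> z}"

text \<open>The subgroup \<open>G\<^sup>q[G,G]\<close>; for \<open>q = 0\<close> the powers contribute only \<open>\<one>\<close>.\<close>

definition q_derived :: "nat \<Rightarrow> ('a, 'b) monoid_scheme \<Rightarrow> 'a set" where
  "q_derived q G = generate G
    ({g [^]\<^bsub>G\<^esub> q | g. g \<in> carrier G} \<union>
     {commutator G g h | g h. g \<in> carrier G \<and> h \<in> carrier G})"

subsection \<open>The q-tensor square\<close>

text \<open>\<open>Tens g h\<close> is the symbol \<open>g \<otimes> h\<close> and \<open>Diag g\<close> the symbol \<open>{(g,g)}\<close>.\<close>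

datatype 'a qgen = Tens 'a 'a | Diag 'a

abbreviation tens :: "'a \<Rightarrow> 'a \<Rightarrow> 'a qgen word" where
  "tens g h \<equiv> [(Tens g h, True)]"

abbreviation diag :: "'a \<Rightarrow> 'a qgen word" where
  "diag g \<equiv> [(Diag g, True)]"

definition qgens :: "nat \<Rightarrow> ('a, 'b) monoid_scheme \<Rightarrow> 'a qgen set" where
  "qgens q G = {Tens g h | g h. g \<in> carrier G \<and> h \<in> carrier G} \<union>
    (if q = 0 then {} else Diag ` carrier G)"

definition tensor_rels :: "('a, 'b) monoid_scheme \<Rightarrow> ('a qgen word \<times> 'a qgen word) set" where
  "tensor_rels G =
    {(tens (g \<otimes>\<^bsub>G\<^esub> g1) h, tens (conj_by G g g1) (conj_by G g h) @ tens g h) | g g1 h.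
        g \<in> carrier G \<and> g1 \<in> carrier G \<and> h \<in> carrier G} \<union>
    {(tens g (h \<otimes>\<^bsub>G\<^esub> h1), tens g h @ tens (conj_by G h g) (conj_by G h h1)) | g h h1.
        g \<in> carrier G \<and> h \<in> carrier G \<and> h1 \<in> carrier G}"

text \<open>In the fourth family the exponent \<open>1 - q + i\<close> is a (nonpositive) integer.\<close>

definition diag_rels :: "nat \<Rightarrow> ('a, 'b) monoid_scheme \<Rightarrow> ('a qgen word \<times> 'a qgen word) set" where
  "diag_rels q G =
    {(diag g @ tens g1 h1 @ word_inv (diag g),
      tens (conj_by G (g [^]\<^bsub>G\<^esub> q) g1) (conj_by G (g [^]\<^bsub>G\<^esub> q) h1)) | g g1 h1.
        g \<in> carrier G \<and> g1 \<in> carrier G \<and> h1 \<in> carrier G} \<union>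
    {(diag (g \<otimes>\<^bsub>G\<^esub> g1),
      diag g @
      concat (map (\<lambda>i. tens (inv\<^bsub>G\<^esub> g)
                        (conj_by G (g [^]\<^bsub>G\<^esub> (1 - int q + int i)) g1 [^]\<^bsub>G\<^esub> i)) [1..<q]) @
      diag g1) | g g1.
        g \<in> carrier G \<and> g1 \<in> carrier G} \<union>
    {(diag g @ diag g1 @ word_inv (diag g) @ word_inv (diag g1),
      tens (g [^]\<^bsub>G\<^esub> q) (g1 [^]\<^bsub>G\<^esub> q)) | g g1.
        g \<in> carrier G \<and> g1 \<in> carrier G} \<union>
    {(diag (commutator G g h), concat (replicate q (tens g h))) | g h.
        g \<in> carrier G \<and> h \<in> carrier G}"

definition qrels :: "nat \<Rightarrow> ('a, 'b) monoid_scheme \<Rightarrow> ('a qgen word \<times> 'a qgen word) set" where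
  "qrels q G = tensor_rels G \<union> (if q = 0 then {} else diag_rels q G)"

definition tensor_square :: "nat \<Rightarrow> ('a, 'b) monoid_scheme \<Rightarrow> 'a qgen word set monoid" where
  "tensor_square q G = presented_group (qgens q G) (qrels q G)"

definition tensor_elt :: "nat \<Rightarrow> ('a, 'b) monoid_scheme \<Rightarrow> 'a qgen word \<Rightarrow> 'a qgen word set" where
  "tensor_elt q G w = word_class (qgens q G) (qrels q G) w"

subsection \<open>The q-exterior square and the q-Schur multiplier\<close>

definition ext_kernel :: "nat \<Rightarrow> ('a, 'b) monoid_scheme \<Rightarrow> 'a qgen word set set" where
  "ext_kernel q G =
    normal_closure (tensor_square q G) {tensor_elt q G (tens g g) | g. g \<in> carrier G}"

definition ext_square :: "nat \<Rightarrow> ('a, 'b) monoid_scheme \<Rightarrow> 'a qgen word set set monoid" where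
  "ext_square q G = tensor_square q G Mod ext_kernel q G"

definition ext_elt :: "nat \<Rightarrow> ('a, 'b) monoid_scheme \<Rightarrow> 'a qgen word \<Rightarrow> 'a qgen word set set" where
  "ext_elt q G w = ext_kernel q G #>\<^bsub>tensor_square q G\<^esub> tensor_elt q G w"

definition wedge :: "nat \<Rightarrow> ('a, 'b) monoid_scheme \<Rightarrow> 'a \<Rightarrow> 'a \<Rightarrow> 'a qgen word set set" where
  "wedge q G g h = ext_elt q G (tens g h)"

definition ext_diag :: "nat \<Rightarrow> ('a, 'b) monoid_scheme \<Rightarrow> 'a \<Rightarrow> 'a qgen word set set" where
  "ext_diag q G g = ext_elt q G (diag g)"

primrec eta_gen :: "nat \<Rightarrow> ('a, 'b) monoid_scheme \<Rightarrow> 'a qgen \<Rightarrow> 'a" where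
  "eta_gen q G (Tens g h) = commutator G g h"
| "eta_gen q G (Diag g) = g [^]\<^bsub>G\<^esub> q"

text \<open>An element of the exterior square is a set of classes of words; \<open>eta\<close> evaluates any word
  representing it. Lemmas \<open>eta_hom\<close>, \<open>eta_wedge\<close> and \<open>eta_ext_diag\<close> below show that this is
  independent of the word and yields the homomorphism with \<open>x \<and> y \<mapsto> [x,y]\<close> and
  \<open>{(g,g)} \<mapsto> g\<^sup>q\<close>.\<close>

definition eta :: "nat \<Rightarrow> ('a, 'b) monoid_scheme \<Rightarrow> 'a qgen word set set \<Rightarrow> 'a" where
  "eta q G c = word_val G (eta_gen q G) (SOME w. \<exists>t\<in>c. w \<in> t)"

definition Mq :: "nat \<Rightarrow> ('a, 'b) monoid_scheme \<Rightarrow> 'a qgen word set set set" where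
  "Mq q G = kernel (ext_square q G) G (eta q G)"

subsection \<open>Bogomolov multipliers\<close>

definition M0 :: "nat \<Rightarrow> ('a, 'b) monoid_scheme \<Rightarrow> 'a qgen word set set set" where
  "M0 q G = generate (ext_square q G)
    {wedge q G x y | x y. x \<in> carrier G \<and> y \<in> carrier G \<and> commutator G x y = \<one>\<^bsub>G\<^esub>}"

definition M0_hat :: "nat \<Rightarrow> ('a, 'b) monoid_scheme \<Rightarrow> 'a qgen word set set set" where
  "M0_hat q G = generate (ext_square q G)
    ({wedge q G x y | x y. x \<in> carrier G \<and> y \<in> carrier G \<and> commutator G x y = \<one>\<^bsub>G\<^esub>} \<union>
     (if q = 0 then {} else {ext_diag q G g | g. g \<in> carrier G \<and> g [^]\<^bsub>G\<^esub> q = \<one>\<^bsub>G\<^esub>}))"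

definition B0 :: "nat \<Rightarrow> ('a, 'b) monoid_scheme \<Rightarrow> 'a qgen word set set set monoid" where
  "B0 q G = (ext_square q G)\<lparr>carrier := Mq q G\<rparr> Mod M0 q G"

definition B0_hat :: "nat \<Rightarrow> ('a, 'b) monoid_scheme \<Rightarrow> 'a qgen word set set set monoid" where
  "B0_hat q G = (ext_square q G)\<lparr>carrier := Mq q G\<rparr> Mod M0_hat q G"

subsection \<open>Isoclinism\<close>

definition Zq :: "nat \<Rightarrow> ('a, 'b) monoid_scheme \<Rightarrow> 'a set" where
  "Zq q G = {g \<in> center G. q = 0 \<or> ext_diag q G g \<in> M0 q G}"

definition Zq_hat :: "nat \<Rightarrow> ('a, 'b) monoid_scheme \<Rightarrow> 'a set" where
  "Zq_hat q G = {g \<in> center G. g [^]\<^bsub>G\<^esub> q = \<one>\<^bsub>G\<^esub>}"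

definition isoclinic_mod ::
  "nat \<Rightarrow> ('a, 'c) monoid_scheme \<Rightarrow> 'a set \<Rightarrow> ('b, 'd) monoid_scheme \<Rightarrow> 'b set \<Rightarrow> bool" where
  "isoclinic_mod q G Z H W \<longleftrightarrow>
    (\<exists>\<alpha> \<beta>. \<alpha> \<in> iso (G Mod Z) (H Mod W) \<and>
      \<beta> \<in> iso (G\<lparr>carrier := q_derived q G\<rparr>) (H\<lparr>carrier := q_derived q H\<rparr>) \<and>
      (\<forall>a1\<in>carrier G. \<forall>b1\<in>carrier G. \<forall>a2\<in>carrier H. \<forall>b2\<in>carrier H.
        \<alpha> (Z #>\<^bsub>G\<^esub> a1) = W #>\<^bsub>H\<^esub> a2 \<and> \<alpha> (Z #>\<^bsub>G\<^esub> b1) = W #>\<^bsub>H\<^esub> b2 \<longrightarrow>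
          \<beta> (commutator G a1 b1) = commutator H a2 b2 \<and>
          \<beta> (a1 [^]\<^bsub>G\<^esub> q) = a2 [^]\<^bsub>H\<^esub> q))"

definition q_isoclinic :: "nat \<Rightarrow> ('a, 'c) monoid_scheme \<Rightarrow> ('b, 'd) monoid_scheme \<Rightarrow> bool" where
  "q_isoclinic q G H \<longleftrightarrow> isoclinic_mod q G (Zq q G) H (Zq q H)"

definition q_hat_isoclinic :: "nat \<Rightarrow> ('a, 'c) monoid_scheme \<Rightarrow> ('b, 'd) monoid_scheme \<Rightarrow> bool" where
  "q_hat_isoclinic q G H \<longleftrightarrow> isoclinic_mod q G (Zq_hat q G) H (Zq_hat q H)"

subsection \<open>The homomorphism eta is well defined\<close>

lemma words_simps [simp]:
  "[] \<in> words S" "p # w \<in> words S \<longleftrightarrow> fst p \<in> S \<and> w \<in> words S"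
  "u @ v \<in> words S \<longleftrightarrow> u \<in> words S \<and> v \<in> words S"
  "word_inv w \<in> words S \<longleftrightarrow> w \<in> words S"
  by (auto simp: words_def word_inv_def image_subset_iff case_prod_beta)

lemma word_eq_words: "word_eq S R u v \<Longrightarrow> u \<in> words S \<and> v \<in> words S"
  by (induction rule: word_eq.induct) auto

lemma word_eq_app:
  assumes "word_eq S R u v" "a \<in> words S" "b \<in> words S"
  shows "word_eq S R (a @ u @ b) (a @ v @ b)"
  using assms
proof (induction rule: word_eq.induct)
  case (cancel u v x c)
  then show ?case using word_eq.cancel[of "a @ u" S "v @ b" x R c] by simp
next
  case (rel r s u v)
  then show ?case using word_eq.rel[of r s R S "a @ u" "v @ b"] by simp
next
  case (trans u v w)
  then show ?case by (meson word_eq.trans)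
qed (auto intro: word_eq.intros)

lemma word_eq_append:
  assumes "word_eq S R u u'" "word_eq S R v v'"
  shows "word_eq S R (u @ v) (u' @ v')"
proof -
  have "word_eq S R (u @ v) (u' @ v)"
    using word_eq_app[OF assms(1), of "[]" v] word_eq_words[OF assms(2)] by simp
  moreover have "word_eq S R (u' @ v) (u' @ v')"
    using word_eq_app[OF assms(2), of u' "[]"] word_eq_words[OF assms(1)] by simp
  ultimately show ?thesis by (rule word_eq.trans)
qed

lemma word_class_eq:
  assumes "word_eq S R u v" shows "word_class S R u = word_class S R v"
  using assms unfolding word_class_def by (blast intro: word_eq.trans word_eq.sym)

lemma word_eq_inv: "w \<in> words S \<Longrightarrow> word_eq S R (word_inv w @ w) []"
proof (induction w)
  case Nil
  then show ?case by (simp add: word_inv_def word_eq.refl)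
next
  case (Cons p w)
  obtain x b where p: "p = (x, b)" by (cases p)
  have "word_eq S R (word_inv w @ [(x, \<not> b), (x, \<not> \<not> b)] @ w) (word_inv w @ w)"
    using Cons.prems p by (intro word_eq.cancel) auto
  moreover have "word_eq S R (word_inv w @ w) []" using Cons by simp
  ultimately have "word_eq S R (word_inv w @ [(x, \<not> b), (x, \<not> \<not> b)] @ w) []"
    by (rule word_eq.trans)
  then show ?case using p by (simp add: word_inv_def)
qed

lemma presented_group_mult:
  assumes "u \<in> words S" "v \<in> words S"
  shows "word_class S R u \<otimes>\<^bsub>presented_group S R\<^esub> word_class S R v = word_class S R (u @ v)"
proof -
  have "word_eq S R (u @ v) w"
    if "word_eq S R u u'" "word_eq S R v v'" "word_eq S R (u' @ v') w" for u' v' w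
    using word_eq.trans[OF word_eq_append[OF that(1,2)] that(3)] .
  then show ?thesis
    using word_eq.refl[OF assms(1), of R] word_eq.refl[OF assms(2), of R]
    unfolding presented_group_def word_class_def by auto
qed

lemma group_presented_group: "group (presented_group S R)"
proof (rule groupI)
  let ?P = "presented_group S R"
  have car: "carrier ?P = word_class S R ` words S" and one: "\<one>\<^bsub>?P\<^esub> = word_class S R []"
    by (auto simp: presented_group_def)
  show "x \<otimes>\<^bsub>?P\<^esub> y \<in> carrier ?P" if "x \<in> carrier ?P" "y \<in> carrier ?P" for x y
    using that unfolding car by (auto simp: presented_group_mult)
  show "\<one>\<^bsub>?P\<^esub> \<in> carrier ?P" unfolding car one by simp
  show "x \<otimes>\<^bsub>?P\<^esub> y \<otimes>\<^bsub>?P\<^esub> z = x \<otimes>\<^bsub>?P\<^esub> (y \<otimes>\<^bsub>?P\<^esub> z)"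
    if "x \<in> carrier ?P" "y \<in> carrier ?P" "z \<in> carrier ?P" for x y z
    using that unfolding car by (auto simp: presented_group_mult)
  show "\<one>\<^bsub>?P\<^esub> \<otimes>\<^bsub>?P\<^esub> x = x" if "x \<in> carrier ?P" for x
    using that unfolding car one by (auto simp: presented_group_mult)
  show "\<exists>y\<in>carrier ?P. y \<otimes>\<^bsub>?P\<^esub> x = \<one>\<^bsub>?P\<^esub>" if "x \<in> carrier ?P" for x
  proof -
    obtain w where w: "w \<in> words S" "x = word_class S R w" using \<open>x \<in> carrier ?P\<close> car by auto
    have "word_class S R (word_inv w) \<otimes>\<^bsub>?P\<^esub> x = \<one>\<^bsub>?P\<^esub>"
      using w word_class_eq[OF word_eq_inv[OF w(1)]] by (simp add: presented_group_mult one)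
    then show ?thesis using w car by auto
  qed
qed

context group begin

lemma word_val_simps [simp]:
  "word_val G f [] = \<one>"
  "word_val G f ((x, b) # w) = (if b then f x else inv (f x)) \<otimes> word_val G f w"
  by (simp_all add: word_val_def)

lemma word_val_closed:
  assumes "f \<in> S \<rightarrow> carrier G" "w \<in> words S" shows "word_val G f w \<in> carrier G"
  using assms(2) by (induction w) (use assms(1) in \<open>auto simp: Pi_iff\<close>)

lemma word_val_append:
  assumes "f \<in> S \<rightarrow> carrier G" "u \<in> words S" "v \<in> words S"
  shows "word_val G f (u @ v) = word_val G f u \<otimes> word_val G f v"
  using assms(2)
proof (induction u)
  case Nil
  then show ?case using word_val_closed[OF assms(1,3)] by simp
next
  case (Cons p u)
  then have "f (fst p) \<in> carrier G" using assms(1) by auto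
  then show ?case
    using Cons word_val_closed[OF assms(1)] assms(3) by (cases p) (simp add: m_assoc)
qed

lemma word_val_eq:
  assumes f: "f \<in> S \<rightarrow> carrier G"
    and R: "\<And>r s. (r, s) \<in> R \<Longrightarrow> word_val G f r = word_val G f s"
    and "word_eq S R u v"
  shows "word_val G f u = word_val G f v"
  using assms(3)
proof (induction rule: word_eq.induct)
  case (cancel u v x b)
  then have "f x \<in> carrier G" "word_val G f v \<in> carrier G"
    using f word_val_closed[OF f] by auto
  then have "word_val G f ([(x, b), (x, \<not> b)] @ v) = word_val G f v"
    by (simp add: m_assoc[symmetric])
  then show ?case
    using cancel word_val_append[OF f, of u "[(x, b), (x, \<not> b)] @ v"] word_val_append[OF f, of u v]
    by auto
next
  case (rel r s u v)
  then show ?case using R by (simp add: word_val_append[OF f])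
qed auto

lemma commutator_closed [simp]:
  "g \<in> carrier G \<Longrightarrow> h \<in> carrier G \<Longrightarrow> commutator G g h \<in> carrier G"
  by (simp add: commutator_def)

lemma conj_by_closed [simp]:
  "g \<in> carrier G \<Longrightarrow> h \<in> carrier G \<Longrightarrow> conj_by G g h \<in> carrier G"
  by (simp add: conj_by_def)

lemma eta_gen_closed: "eta_gen q G \<in> qgens q G \<rightarrow> carrier G"
  by (auto simp: qgens_def)

lemma inv_cancel_left:
  "x \<in> carrier G \<Longrightarrow> y \<in> carrier G \<Longrightarrow> inv x \<otimes> (x \<otimes> y) = y"
  "x \<in> carrier G \<Longrightarrow> y \<in> carrier G \<Longrightarrow> x \<otimes> (inv x \<otimes> y) = y"
  by (simp_all add: m_assoc[symmetric])

lemma pow_comm: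
  "x \<in> carrier G \<Longrightarrow> x \<otimes> x [^] (n::nat) = x [^] n \<otimes> x"
  by (metis nat_pow_Suc nat_pow_Suc2)

lemma word_val_tens_power:
  assumes "g \<in> carrier G" "h \<in> carrier G"
  shows "word_val G (eta_gen q G) (concat (replicate n (tens g h))) = commutator G g h [^] n"
  by (induction n) (use assms in \<open>auto simp: pow_comm\<close>)

lemma conj_by_pow:
  assumes "g \<in> carrier G" "x \<in> carrier G"
  shows "conj_by G g x [^] (n::nat) = conj_by G g (x [^] n)"
  by (induction n) (use assms in \<open>simp_all add: conj_by_def m_assoc inv_cancel_left\<close>)

lemma eta_factor:
  fixes k :: int
  assumes "g \<in> carrier G" "y \<in> carrier G"
  shows "commutator G (inv g) (conj_by G (g [^] k) y) = g [^] (k - 1) \<otimes> y \<otimes> g \<otimes> inv y \<otimes> g [^] (- k)"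
proof -
  have e: "g [^] (k - 1) = inv g \<otimes> g [^] k"
    using int_pow_mult[OF assms(1), of "-1" k] assms by (simp add: int_pow_neg)
  have c: "g \<otimes> g [^] k = g [^] k \<otimes> g"
    using int_pow_mult[OF assms(1), of 1 k] int_pow_mult[OF assms(1), of k 1] assms
    by (simp add: add.commute)
  have c2: "inv (g [^] k) \<otimes> (g \<otimes> (g [^] k \<otimes> z)) = g \<otimes> z" if "z \<in> carrier G" for z
  proof -
    have "g \<otimes> (g [^] k \<otimes> z) = g [^] k \<otimes> (g \<otimes> z)"
      using c that assms by (simp add: m_assoc[symmetric])
    then show ?thesis using that assms by (simp add: inv_cancel_left)
  qed
  show ?thesis
    using assms unfolding commutator_def conj_by_def e int_pow_neg[OF assms(1)]
    by (simp add: m_assoc inv_mult_group inv_cancel_left c2)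
qed

lemma word_val_concat:
  assumes "g \<in> carrier G" "x \<in> carrier G"
  shows "word_val G (eta_gen q G)
     (concat (map (\<lambda>i. tens (inv g) (conj_by G (g [^] (1 - int m + int i)) x [^] i)) [1..<Suc n]))
    = g [^] (1 - int m) \<otimes> (x \<otimes> g) [^] n \<otimes> inv (x [^] n) \<otimes> g [^] (int m - 1 - int n)"
    (is "word_val G _ (?W n) = ?V n")
proof (induction n)
  case 0
  have "g [^] (1 - int m) \<otimes> g [^] (int m - 1) = \<one>"
    using int_pow_mult[OF assms(1), of "1 - int m" "int m - 1"] by simp
  then show ?case using assms by simp
next
  case (Suc n)
  let ?k = "1 - int m + int (Suc n)"
  have W: "?W n \<in> words (qgens m G)" using assms by (auto simp: words_def qgens_def)
  have L: "tens (inv g) (conj_by G (g [^] ?k) x [^] Suc n) \<in> words (qgens m G)"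
    using assms by (auto simp: qgens_def)
  have f: "eta_gen q G \<in> qgens m G \<rightarrow> carrier G" by (auto simp: qgens_def)
  have c: "g [^] (int m - 1 - int n) \<otimes> (g [^] (?k - 1) \<otimes> z) = z" if "z \<in> carrier G" for z
  proof -
    have "g [^] (int m - 1 - int n) \<otimes> g [^] (?k - 1) = \<one>"
      using int_pow_mult[OF assms(1), of "int m - 1 - int n" "?k - 1", symmetric] by simp
    then show ?thesis using that assms by (simp add: m_assoc[symmetric])
  qed
  have k: "- ?k = int m - 1 - int (Suc n)" by simp
  have "word_val G (eta_gen q G) (?W (Suc n)) =
      word_val G (eta_gen q G) (?W n @ tens (inv g) (conj_by G (g [^] ?k) x [^] Suc n))"
    by simp
  also have "\<dots> = ?V n \<otimes> commutator G (inv g) (conj_by G (g [^] ?k) (x [^] Suc n))"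
    unfolding word_val_append[OF f W L] Suc.IH using assms conj_by_pow[of "g [^] ?k" x "Suc n"]
    by simp
  also have "\<dots> = ?V n \<otimes> (g [^] (?k - 1) \<otimes> x [^] Suc n \<otimes> g \<otimes> inv (x [^] Suc n)
      \<otimes> g [^] (int m - 1 - int (Suc n)))"
    using assms by (subst eta_factor) (simp_all only: k nat_pow_closed)
  also have "\<dots> = g [^] (1 - int m) \<otimes> (x \<otimes> g) [^] n \<otimes> (inv (x [^] n)
      \<otimes> (x [^] Suc n \<otimes> (g \<otimes> (inv (x [^] Suc n) \<otimes> g [^] (int m - 1 - int (Suc n))))))"
    using assms c by (simp only: m_assoc m_closed int_pow_closed nat_pow_closed inv_closed)
  also have "\<dots> = ?V (Suc n)"
    using assms by (simp add: m_assoc inv_cancel_left)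
  finally show ?case .
qed

lemma diag_eta:
  assumes "g \<in> carrier G" "x \<in> carrier G" "q > 0"
  shows "g [^] q \<otimes> (g [^] (1 - int q) \<otimes> (x \<otimes> g) [^] (q - 1) \<otimes> inv (x [^] (q - 1))
      \<otimes> g [^] (int q - 1 - int (q - 1))) \<otimes> x [^] q = (g \<otimes> x) [^] q"
proof -
  obtain n where n: "q = Suc n" using assms(3) by (cases q) auto
  have "g [^] q \<otimes> g [^] (1 - int q) = g"
    using int_pow_mult[OF assms(1), of "int q" "1 - int q"] assms(1) by (simp add: int_pow_int)
  then have 1: "g [^] q \<otimes> (g [^] (1 - int q) \<otimes> z) = g \<otimes> z" if "z \<in> carrier G" for z
    using assms that by (simp add: m_assoc[symmetric])
  have 2: "g \<otimes> ((x \<otimes> g) [^] n \<otimes> x) = (g \<otimes> x) [^] Suc n" for n :: nat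
  proof (induction n)
    case (Suc n)
    have "g \<otimes> ((x \<otimes> g) [^] Suc n \<otimes> x) = g \<otimes> ((x \<otimes> g) [^] n \<otimes> x) \<otimes> (g \<otimes> x)"
      using assms by (simp add: m_assoc)
    then show ?case using Suc by simp
  qed (use assms in simp)
  have "g [^] q \<otimes> (g [^] (1 - int q) \<otimes> (x \<otimes> g) [^] n \<otimes> inv (x [^] n)) \<otimes> x [^] Suc n
      = g \<otimes> ((x \<otimes> g) [^] n \<otimes> (inv (x [^] n) \<otimes> (x [^] n \<otimes> x)))"
    using assms 1 by (simp add: m_assoc)
  also have "\<dots> = (g \<otimes> x) [^] Suc n" using assms 2 by (simp add: inv_cancel_left)
  finally show ?thesis using assms n by simp
qed

lemma eta_rel_tens:
  assumes "g \<in> carrier G" "g1 \<in> carrier G" "h \<in> carrier G"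
  shows "commutator G (g \<otimes> g1) h = commutator G (conj_by G g g1) (conj_by G g h) \<otimes> commutator G g h"
    and "commutator G h (g \<otimes> g1) = commutator G h g \<otimes> commutator G (conj_by G g h) (conj_by G g g1)"
    and "commutator G (conj_by G g g1) (conj_by G g h) = g \<otimes> (commutator G g1 h \<otimes> inv g)"
  using assms by (simp_all add: commutator_def conj_by_def m_assoc inv_mult_group inv_cancel_left)

lemma eta_rels:
  assumes "(r, s) \<in> qrels q G"
  shows "word_val G (eta_gen q G) r = word_val G (eta_gen q G) s"
proof (cases "(r, s) \<in> tensor_rels G")
  case True
  then show ?thesis unfolding tensor_rels_def
    by (elim UnE CollectE exE conjE; clarify) (simp_all add: eta_rel_tens)
next
  case False
  then have D: "(r, s) \<in> diag_rels q G" and q: "q > 0"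
    using assms by (simp_all add: qrels_def split: if_splits)
  have 4: "word_val G (eta_gen q G) (diag (g \<otimes> g1)) = word_val G (eta_gen q G)
      (diag g @ concat (map (\<lambda>i. tens (inv g)
         (conj_by G (g [^] (1 - int q + int i)) g1 [^] i)) [1..<q]) @ diag g1)"
    if g: "g \<in> carrier G" "g1 \<in> carrier G" for g g1
  proof -
    let ?W = "concat (map (\<lambda>i. tens (inv g)
            (conj_by G (g [^] (1 - int q + int i)) g1 [^] i)) [1..<q])"
    have W: "?W \<in> words (qgens q G)" and d: "diag g1 \<in> words (qgens q G)"
      using g q by (auto simp: words_def qgens_def)
    have "Suc (q - 1) = q" using q by simp
    then have V: "word_val G (eta_gen q G) ?W = g [^] (1 - int q) \<otimes> (g1 \<otimes> g) [^] (q - 1)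
        \<otimes> inv (g1 [^] (q - 1)) \<otimes> g [^] (int q - 1 - int (q - 1))"
      using word_val_concat[OF g, of q q "q - 1"] by (simp only:)
    have "word_val G (eta_gen q G) (diag g @ ?W @ diag g1)
        = g [^] q \<otimes> (word_val G (eta_gen q G) ?W \<otimes> g1 [^] q)"
      using g word_val_append[OF eta_gen_closed W d] by simp
    then show ?thesis
      using diag_eta[OF g q] g word_val_closed[OF eta_gen_closed W]
      by (simp only: V) (simp add: m_assoc)
  qed
  have 3: "word_val G (eta_gen q G) (diag g @ tens g1 h1 @ word_inv (diag g)) =
      word_val G (eta_gen q G) (tens (conj_by G (g [^] q) g1) (conj_by G (g [^] q) h1))"
    if "g \<in> carrier G" "g1 \<in> carrier G" "h1 \<in> carrier G" for g g1 h1
    using that by (simp add: word_inv_def eta_rel_tens(3))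
  have 5: "word_val G (eta_gen q G) (diag g @ diag g1 @ word_inv (diag g) @ word_inv (diag g1)) =
      word_val G (eta_gen q G) (tens (g [^] q) (g1 [^] q))"
    if "g \<in> carrier G" "g1 \<in> carrier G" for g g1
    using that by (simp add: word_inv_def commutator_def m_assoc)
  have 6: "word_val G (eta_gen q G) (diag (commutator G g h)) =
      word_val G (eta_gen q G) (concat (replicate q (tens g h)))"
    if "g \<in> carrier G" "h \<in> carrier G" for g h
    using that by (simp only: word_val_tens_power) simp
  show ?thesis using D unfolding diag_rels_def
    by (elim UnE CollectE exE conjE; simp only: prod.inject; elim conjE)
      (simp_all only: 3 4 5 6)
qed

end

lemma group_tensor_square: "group (tensor_square q G)"
  by (simp add: tensor_square_def group_presented_group)

lemma normal_closure_normal: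
  fixes G (structure)
  assumes "group G" "S \<subseteq> carrier G" shows "normal_closure G S \<lhd> G"
proof -
  interpret group G by fact
  show ?thesis unfolding normal_closure_def
  proof (rule normal_generateI)
    show "{conj_by G g s |g s. g \<in> carrier G \<and> s \<in> S} \<subseteq> carrier G" using assms(2) by auto
    fix h g assume "h \<in> {conj_by G g s |g s. g \<in> carrier G \<and> s \<in> S}" and g: "g \<in> carrier G"
    then obtain k s where h: "h = conj_by G k s" "k \<in> carrier G" "s \<in> S" by auto
    then have "g \<otimes> h \<otimes> inv g = conj_by G (g \<otimes> k) s"
      using g assms(2) by (simp add: conj_by_def subsetD m_assoc inv_mult_group)
    then show "g \<otimes> h \<otimes> inv g \<in> {conj_by G g s |g s. g \<in> carrier G \<and> s \<in> S}"
      using h g by auto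
  qed
qed

lemma tens_in_words:
  "g \<in> carrier G \<Longrightarrow> h \<in> carrier G \<Longrightarrow> tens g h \<in> words (qgens q G)"
  "g \<in> carrier G \<Longrightarrow> q > 0 \<Longrightarrow> diag g \<in> words (qgens q G)"
  by (auto simp: qgens_def)

lemma tensor_elt_carrier: "carrier (tensor_square q G) = tensor_elt q G ` words (qgens q G)"
  by (auto simp: tensor_square_def tensor_elt_def presented_group_def)

lemma ext_kernel_normal: "ext_kernel q G \<lhd> tensor_square q G"
  unfolding ext_kernel_def
  by (rule normal_closure_normal[OF group_tensor_square])
    (auto simp: tensor_elt_carrier simp del: words_simps intro!: imageI tens_in_words)

lemma group_ext_square: "group (ext_square q G)"
  unfolding ext_square_def by (rule normal.factorgroup_is_group[OF ext_kernel_normal])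

lemma carrier_ext_square: "carrier (ext_square q G) = ext_elt q G ` words (qgens q G)"
  by (auto simp: ext_square_def FactGroup_def RCOSETS_def ext_elt_def tensor_elt_carrier)

lemma ext_elt_mult:
  assumes "u \<in> words (qgens q G)" "v \<in> words (qgens q G)"
  shows "ext_elt q G u \<otimes>\<^bsub>ext_square q G\<^esub> ext_elt q G v = ext_elt q G (u @ v)"
proof -
  have "tensor_elt q G u \<otimes>\<^bsub>tensor_square q G\<^esub> tensor_elt q G v = tensor_elt q G (u @ v)"
    unfolding tensor_square_def tensor_elt_def by (rule presented_group_mult[OF assms])
  then show ?thesis
    unfolding ext_square_def ext_elt_def FactGroup_def using assms
    by (simp add: normal.rcos_sum[OF ext_kernel_normal] tensor_elt_carrier)
qed

context group begin

lemma tensor_elt_val: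
  assumes "v \<in> tensor_elt q G w"
  shows "word_val G (eta_gen q G) v = word_val G (eta_gen q G) w"
proof -
  have "word_eq (qgens q G) (qrels q G) w v"
    using assms by (simp add: tensor_elt_def word_class_def)
  then show ?thesis using word_val_eq[OF eta_gen_closed eta_rels] by metis
qed

lemma tensor_elt_mult:
  assumes "u \<in> words (qgens q G)" "v \<in> words (qgens q G)"
  shows "tensor_elt q G u \<otimes>\<^bsub>tensor_square q G\<^esub> tensor_elt q G v = tensor_elt q G (u @ v)"
    unfolding tensor_square_def tensor_elt_def by (rule presented_group_mult[OF assms])

lemma self_tensor_elt: "w \<in> words (qgens q G) \<Longrightarrow> w \<in> tensor_elt q G w"
  by (simp add: tensor_elt_def word_class_def word_eq.refl)

lemma tensor_hom:
  "(\<lambda>t. word_val G (eta_gen q G) (SOME w. w \<in> t)) \<in> hom (tensor_square q G) G"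
  (is "?e \<in> _")
  and tensor_hom_elt: "w \<in> words (qgens q G) \<Longrightarrow>
    word_val G (eta_gen q G) (SOME v. v \<in> tensor_elt q G w) = word_val G (eta_gen q G) w"
proof -
  show e: "word_val G (eta_gen q G) (SOME v. v \<in> tensor_elt q G w) = word_val G (eta_gen q G) w"
    if "w \<in> words (qgens q G)" for w
    using self_tensor_elt[OF that] by (intro tensor_elt_val) (rule someI)
  show "?e \<in> hom (tensor_square q G) G"
    by (rule homI) (auto simp: tensor_elt_carrier tensor_elt_mult e
        word_val_closed[OF eta_gen_closed] word_val_append[OF eta_gen_closed])
qed

lemma ext_kernel_val:
  assumes "n \<in> ext_kernel q G" "v \<in> n" shows "word_val G (eta_gen q G) v = \<one>"
proof -
  let ?T = "tensor_square q G"
  define e where "e t = word_val G (eta_gen q G) (SOME w. w \<in> t)" for t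
  interpret T: group ?T by (rule group_tensor_square)
  interpret e: group_hom ?T G e
    using tensor_hom[of q] by unfold_locales (simp add: e_def[abs_def])
  have "ext_kernel q G \<subseteq> kernel ?T G e"
    unfolding ext_kernel_def normal_closure_def
  proof (rule T.generate_subgroup_incl[OF _ e.subgroup_kernel], clarify)
    fix t g assume t: "t \<in> carrier ?T" and g: "g \<in> carrier G"
    have c: "tensor_elt q G (tens g g) \<in> carrier ?T"
      unfolding tensor_elt_carrier using tens_in_words(1)[OF g g] by blast
    have "e (tensor_elt q G (tens g g)) = \<one>"
      using tensor_hom_elt[OF tens_in_words(1)[OF g g], where q=q] g
      by (simp add: e_def commutator_def m_assoc inv_cancel_left)
    then show "conj_by ?T t (tensor_elt q G (tens g g)) \<in> kernel ?T G e"
      using t c by (simp add: kernel_def conj_by_def)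
  qed
  then have n: "n \<in> carrier ?T" "e n = \<one>" using assms(1) by (auto simp: kernel_def)
  then obtain w where w: "w \<in> words (qgens q G)" "n = tensor_elt q G w"
    by (auto simp: tensor_elt_carrier)
  then show ?thesis using tensor_elt_val[of v q w] tensor_hom_elt[OF w(1)] n assms by (simp add: e_def)
qed

lemma eta_ext_elt:
  assumes w: "w \<in> words (qgens q G)"
  shows "eta q G (ext_elt q G w) = word_val G (eta_gen q G) w"
proof -
  interpret N: normal "ext_kernel q G" "tensor_square q G" by (rule ext_kernel_normal)
  have "tensor_elt q G w \<in> ext_elt q G w"
    unfolding ext_elt_def using w by (intro N.rcos_self) (auto simp: tensor_elt_carrier N.subgroup_axioms)
  then have ex: "\<exists>v. \<exists>t\<in>ext_elt q G w. v \<in> t" using self_tensor_elt[OF w] by blast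
  have "word_val G (eta_gen q G) v = word_val G (eta_gen q G) w"
    if vt: "t \<in> ext_elt q G w" "v \<in> t" for v t
  proof -
    obtain n where n: "n \<in> ext_kernel q G" "t = n \<otimes>\<^bsub>tensor_square q G\<^esub> tensor_elt q G w"
      using vt(1) by (auto simp: ext_elt_def r_coset_def)
    then obtain u where u: "u \<in> words (qgens q G)" "n = tensor_elt q G u"
      using N.subset by (auto simp: tensor_elt_carrier)
    have "v \<in> tensor_elt q G (u @ w)" using vt(2) n u w by (simp add: tensor_elt_mult)
    then have "word_val G (eta_gen q G) v = word_val G (eta_gen q G) (u @ w)" by (rule tensor_elt_val)
    also have "\<dots> = word_val G (eta_gen q G) w"
      using ext_kernel_val[OF n(1), of u] u w self_tensor_elt[OF u(1)]
      by (simp add: word_val_append[OF eta_gen_closed] word_val_closed[OF eta_gen_closed])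
    finally show ?thesis .
  qed
  then show ?thesis unfolding eta_def using someI_ex[OF ex] by blast
qed

end

lemma eta_hom: "group G \<Longrightarrow> eta q G \<in> hom (ext_square q G) G"
  by (rule homI) (auto simp: carrier_ext_square ext_elt_mult group.eta_ext_elt
        group.word_val_closed[OF _ group.eta_gen_closed]
        group.word_val_append[OF _ group.eta_gen_closed])

lemma eta_wedge:
  "group G \<Longrightarrow> g \<in> carrier G \<Longrightarrow> h \<in> carrier G \<Longrightarrow> eta q G (wedge q G g h) = commutator G g h"
  by (simp add: wedge_def group.eta_ext_elt tens_in_words group.word_val_simps
      group.commutator_closed monoid.r_one group.is_monoid del: words_simps)

lemma eta_ext_diag:
  "group G \<Longrightarrow> q > 0 \<Longrightarrow> g \<in> carrier G \<Longrightarrow> eta q G (ext_diag q G g) = g [^]\<^bsub>G\<^esub> q"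
  by (simp add: ext_diag_def group.eta_ext_elt tens_in_words group.word_val_simps
      monoid.nat_pow_closed monoid.r_one group.is_monoid del: words_simps)

end

theory Submission
  imports Defs
begin

text \<open>
  An isoclinism gives an isomorphism \<open>\<alpha> : G/Z \<rightarrow> H/W\<close> of central quotients. The choice of a
  representative \<open>\<sigma> g\<close> of each coset \<open>\<alpha> (g Z)\<close> gives a map \<open>\<sigma> : G \<rightarrow> H\<close>,
  which is a homomorphism only up to factors in \<open>W\<close>. The point is that \<open>x \<and> y \<mapsto> \<sigma> x \<and> \<sigma> y\<close>,
  \<open>{(x,x)} \<mapsto> {(\<sigma> x, \<sigma> x)}\<close> nevertheless defines a homomorphism from \<open>G \<and>\<^sup>q G\<close> to the quotient
  of \<open>H \<and>\<^sup>q H\<close> by \<open>M\<^sub>0\<^sup>q(H)\<close>, since this quotient does not see factors in \<open>W\<close>: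
  if \<open>w\<close> is central, then \<open>xw \<and> y\<close> and \<open>x \<and> y\<close> differ by \<open>w \<and> y'\<close> for some \<open>y'\<close>,
  a wedge of commuting elements; and \<open>{(xw,xw)}\<close> is the product of \<open>{(x,x)}\<close>, of wedges \<open>x\<^sup>-\<^sup>1 \<and> w\<^sup>i\<close> of
  commuting elements, and of \<open>{(w,w)}\<close>, which is trivial in the quotient by the definition of \<open>W\<close>
  (lemmas \<open>bog_elt_tens_cong\<close>, \<open>bog_elt_diag_cong\<close>). So each relation of \<open>G \<and>\<^sup>q G\<close> goes to one of
  \<open>H \<and>\<^sup>q H\<close> (lemma \<open>q_pairing_transport\<close>).

  The second isomorphism \<open>\<beta>\<close> of the isoclinism satisfies \<open>\<beta> [x,y] = [\<sigma> x, \<sigma> y]\<close> and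
  \<open>\<beta> (x\<^sup>q) = (\<sigma> x)\<^sup>q\<close>. Hence \<open>\<sigma>\<close> maps commuting pairs to commuting pairs, so the homomorphism
  kills \<open>M\<^sub>0\<^sup>q(G)\<close>; it also intertwines \<open>\<eta>\<close> for \<open>G\<close> and \<open>H\<close> through \<open>\<beta>\<close> (lemma
  \<open>\<beta>_eta\<close>), so it sends classes of elements of \<open>M\<^sup>q(G) = ker \<eta>\<close> to classes of elements of
  \<open>M\<^sup>q(H)\<close>. The result is a homomorphism between the multipliers. Representatives \<open>\<tau>\<close> of \<open>\<alpha>\<^sup>-\<^sup>1\<close> give one in the other direction,
  and as \<open>\<tau> (\<sigma> x)\<close> lies in \<open>x Z\<close>, the two are mutually inverse. The hatted multipliers are treated in the
  same way: \<open>\<sigma>\<close> preserves the condition \<open>x\<^sup>q = 1\<close>, and for \<open>w\<close> in \<open>W\<close> the symbol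
  \<open>{(w,w)}\<close> is among the generators by which one divides.

  For the quotients to be groups, \<open>M\<^sub>0\<^sup>q\<close> and its hatted version must be normal in the exterior square. This rests on
  the identity of Brown and Loday that \<open>g \<and> h\<close> acts by conjugation on \<open>x \<and> y\<close> as \<open>[g,h]\<close> does
  (lemma \<open>tens_conj\<close>).
\<close>

section \<open>Words and their values\<close>

lemma qrels_in_words:
  assumes "group G" "(r, s) \<in> qrels q G"
  shows "r \<in> words (qgens q G)" and "s \<in> words (qgens q G)"
proof -
  interpret group G by fact
  have "r \<in> words (qgens q G) \<and> s \<in> words (qgens q G)"
    using assms(2) unfolding qrels_def tensor_rels_def diag_rels_def
    by (auto simp: words_def qgens_def word_inv_def split: if_splits)
  then show "r \<in> words (qgens q G)" "s \<in> words (qgens q G)" by auto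
qed

lemma (in group) word_val_concat_replicate:
  assumes "f (Tens g h) \<in> carrier G"
  shows "word_val G f (concat (replicate n (tens g h))) = f (Tens g h) [^] n"
  by (induction n) (use assms in \<open>auto simp: pow_comm\<close>)

lemma (in group) word_val_concat_cong:
  assumes "\<And>i. i \<in> set L \<Longrightarrow> f (Tens x (y i)) = f' (Tens x' (y' i))"
  shows "word_val G f (concat (map (\<lambda>i. tens x (y i)) L)) =
    word_val G f' (concat (map (\<lambda>i. tens x' (y' i)) L))"
  using assms by (induction L) auto

lemma word_val_hom:
  assumes "group K" "group L" "h \<in> hom K L" "f \<in> S \<rightarrow> carrier K" "w \<in> words S"
  shows "word_val L (h \<circ> f) w = h (word_val K f w)"
proof -
  interpret group_hom K L h
    using assms(1-3) by (simp add: group_hom_def group_hom_axioms_def)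
  show ?thesis
    using assms(5)
  proof (induction w)
    case (Cons p w)
    then have "f (fst p) \<in> carrier K" "word_val K f w \<in> carrier K"
      using assms(4) G.word_val_closed[OF assms(4)] by auto
    then show ?case using Cons by (cases p) simp
  qed simp
qed

section \<open>Pairings satisfying the relations of the q-exterior square\<close>

text \<open>A pairing is a group \<open>K\<close> with elements satisfying all relations of the q-exterior square of \<open>G\<close>,
  that is, the same thing as a homomorphism \<open>G \<and>\<^sup>q G \<rightarrow> K\<close>. Working with pairings
  allows computations with the defining relations to be made once and then used in the exterior square
  and in all of its quotients.\<close>
locale q_pairing = G: group G + K: group K
  for q :: nat and G :: "('a, 'c) monoid_scheme" and K :: "('k, 'm) monoid_scheme"
    and f :: "'a qgen \<Rightarrow> 'k" +
  assumes f_closed: "f \<in> qgens q G \<rightarrow> carrier K"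
    and f_rel: "(r, s) \<in> qrels q G \<Longrightarrow> word_val K f r = word_val K f s"
    and f_alt: "g \<in> carrier G \<Longrightarrow> f (Tens g g) = \<one>\<^bsub>K\<^esub>"
begin

text \<open>The word between \<open>{(g,g)}\<close> and \<open>{(x,x)}\<close> in the defining relation for \<open>{(gx,gx)}\<close>.\<close>
abbreviation correction_word :: "'a \<Rightarrow> 'a \<Rightarrow> 'a qgen word" where
  "correction_word g x \<equiv> concat (map (\<lambda>i. tens (inv\<^bsub>G\<^esub> g)
     (conj_by G (g [^]\<^bsub>G\<^esub> (1 - int q + int i)) x [^]\<^bsub>G\<^esub> i)) [1..<q])"

lemma tens_closed [simp]:
  "g \<in> carrier G \<Longrightarrow> h \<in> carrier G \<Longrightarrow> f (Tens g h) \<in> carrier K"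
  using f_closed by (auto simp: qgens_def)

lemma diag_closed [simp]: "q > 0 \<Longrightarrow> g \<in> carrier G \<Longrightarrow> f (Diag g) \<in> carrier K"
  using f_closed by (auto simp: qgens_def)

lemma correction_word_closed:
  "g \<in> carrier G \<Longrightarrow> x \<in> carrier G \<Longrightarrow> correction_word g x \<in> words (qgens q G)"
  by (auto simp: words_def qgens_def)

lemma tens_mult_left:
  assumes "g \<in> carrier G" "g1 \<in> carrier G" "h \<in> carrier G"
  shows "f (Tens (g \<otimes>\<^bsub>G\<^esub> g1) h) = f (Tens (conj_by G g g1) (conj_by G g h)) \<otimes>\<^bsub>K\<^esub> f (Tens g h)"
proof -
  have "(tens (g \<otimes>\<^bsub>G\<^esub> g1) h, tens (conj_by G g g1) (conj_by G g h) @ tens g h) \<in> qrels q G"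
    using assms unfolding qrels_def tensor_rels_def by blast
  from f_rel[OF this] show ?thesis using assms by simp
qed

lemma tens_mult_right:
  assumes "g \<in> carrier G" "h \<in> carrier G" "h1 \<in> carrier G"
  shows "f (Tens g (h \<otimes>\<^bsub>G\<^esub> h1)) = f (Tens g h) \<otimes>\<^bsub>K\<^esub> f (Tens (conj_by G h g) (conj_by G h h1))"
proof -
  have "(tens g (h \<otimes>\<^bsub>G\<^esub> h1), tens g h @ tens (conj_by G h g) (conj_by G h h1)) \<in> qrels q G"
    using assms unfolding qrels_def tensor_rels_def by blast
  from f_rel[OF this] show ?thesis using assms by simp
qed

lemma diag_conj:
  assumes "q > 0" "g \<in> carrier G" "g1 \<in> carrier G" "h1 \<in> carrier G"
  shows "f (Diag g) \<otimes>\<^bsub>K\<^esub> f (Tens g1 h1) \<otimes>\<^bsub>K\<^esub> inv\<^bsub>K\<^esub> (f (Diag g)) =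
    f (Tens (conj_by G (g [^]\<^bsub>G\<^esub> q) g1) (conj_by G (g [^]\<^bsub>G\<^esub> q) h1))"
proof -
  have "(diag g @ tens g1 h1 @ word_inv (diag g),
      tens (conj_by G (g [^]\<^bsub>G\<^esub> q) g1) (conj_by G (g [^]\<^bsub>G\<^esub> q) h1)) \<in> qrels q G"
    using assms unfolding qrels_def diag_rels_def by auto
  from f_rel[OF this] show ?thesis using assms by (simp add: word_inv_def K.m_assoc)
qed

lemma diag_mult:
  assumes "q > 0" "g \<in> carrier G" "x \<in> carrier G"
  shows "f (Diag (g \<otimes>\<^bsub>G\<^esub> x)) =
    f (Diag g) \<otimes>\<^bsub>K\<^esub> word_val K f (correction_word g x) \<otimes>\<^bsub>K\<^esub> f (Diag x)"
proof -
  have "(diag (g \<otimes>\<^bsub>G\<^esub> x), diag g @ correction_word g x @ diag x) \<in> qrels q G"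
    using assms unfolding qrels_def diag_rels_def by auto
  from f_rel[OF this] show ?thesis
    using assms K.word_val_append[OF f_closed correction_word_closed[OF assms(2,3)] tens_in_words(2)[OF assms(3,1)]]
      K.word_val_closed[OF f_closed correction_word_closed[OF assms(2,3)]]
    by (simp add: K.m_assoc)
qed

lemma diag_commutator:
  assumes "q > 0" "g \<in> carrier G" "g1 \<in> carrier G"
  shows "commutator K (f (Diag g)) (f (Diag g1)) = f (Tens (g [^]\<^bsub>G\<^esub> q) (g1 [^]\<^bsub>G\<^esub> q))"
proof -
  have "(diag g @ diag g1 @ word_inv (diag g) @ word_inv (diag g1),
      tens (g [^]\<^bsub>G\<^esub> q) (g1 [^]\<^bsub>G\<^esub> q)) \<in> qrels q G"
    using assms unfolding qrels_def diag_rels_def by auto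
  from f_rel[OF this] show ?thesis
    using assms by (simp add: word_inv_def commutator_def K.m_assoc)
qed

lemma diag_of_commutator:
  assumes "q > 0" "g \<in> carrier G" "h \<in> carrier G"
  shows "f (Diag (commutator G g h)) = f (Tens g h) [^]\<^bsub>K\<^esub> q"
proof -
  have "(diag (commutator G g h), concat (replicate q (tens g h))) \<in> qrels q G"
    using assms unfolding qrels_def diag_rels_def by auto
  from f_rel[OF this] show ?thesis
    using assms K.word_val_concat_replicate[of f g h q] by simp
qed

lemma tens_one [simp]:
  assumes "g \<in> carrier G"
  shows "f (Tens \<one>\<^bsub>G\<^esub> g) = \<one>\<^bsub>K\<^esub>" and "f (Tens g \<one>\<^bsub>G\<^esub>) = \<one>\<^bsub>K\<^esub>"
proof -
  have "f (Tens \<one>\<^bsub>G\<^esub> g) = f (Tens \<one>\<^bsub>G\<^esub> g) \<otimes>\<^bsub>K\<^esub> f (Tens \<one>\<^bsub>G\<^esub> g)"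
    using tens_mult_left[of "\<one>\<^bsub>G\<^esub>" "\<one>\<^bsub>G\<^esub>" g] assms by (simp add: conj_by_def)
  then show "f (Tens \<one>\<^bsub>G\<^esub> g) = \<one>\<^bsub>K\<^esub>"
    using assms K.l_cancel_one'[of "f (Tens \<one>\<^bsub>G\<^esub> g)" "f (Tens \<one>\<^bsub>G\<^esub> g)"] by simp
  have "f (Tens g \<one>\<^bsub>G\<^esub>) = f (Tens g \<one>\<^bsub>G\<^esub>) \<otimes>\<^bsub>K\<^esub> f (Tens g \<one>\<^bsub>G\<^esub>)"
    using tens_mult_right[of g "\<one>\<^bsub>G\<^esub>" "\<one>\<^bsub>G\<^esub>"] assms by (simp add: conj_by_def)
  then show "f (Tens g \<one>\<^bsub>G\<^esub>) = \<one>\<^bsub>K\<^esub>"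
    using assms K.l_cancel_one'[of "f (Tens g \<one>\<^bsub>G\<^esub>)" "f (Tens g \<one>\<^bsub>G\<^esub>)"] by simp
qed

text \<open>The Brown--Loday trick: expand \<open>gx \<otimes> hy\<close> once on the left and then on the right, and once in
  the opposite order. The outer factors of the two results agree, so the inner ones do.\<close>
lemma tens_swap:
  assumes g: "g \<in> carrier G" and h: "h \<in> carrier G" and x: "x \<in> carrier G" and y: "y \<in> carrier G"
  shows "f (Tens (conj_by G (g \<otimes>\<^bsub>G\<^esub> h) x) (conj_by G (g \<otimes>\<^bsub>G\<^esub> h) y)) \<otimes>\<^bsub>K\<^esub> f (Tens g h) =
    f (Tens g h) \<otimes>\<^bsub>K\<^esub> f (Tens (conj_by G (h \<otimes>\<^bsub>G\<^esub> g) x) (conj_by G (h \<otimes>\<^bsub>G\<^esub> g) y))"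
proof -
  let ?c = "conj_by G"
  let ?a = "f (Tens (?c g x) (?c g h))" and ?d = "f (Tens (?c h g) (?c h y))"
  have cm: "?c k (u \<otimes>\<^bsub>G\<^esub> v) = ?c k u \<otimes>\<^bsub>G\<^esub> ?c k v"
    if "k \<in> carrier G" "u \<in> carrier G" "v \<in> carrier G" for k u v
    using that by (simp add: conj_by_def G.m_assoc G.inv_cancel_left)
  have cc: "?c (?c k l) (?c k u) = ?c (k \<otimes>\<^bsub>G\<^esub> l) u"
    if "k \<in> carrier G" "u \<in> carrier G" "l \<in> carrier G" for k u l
    using that by (simp add: conj_by_def G.m_assoc G.inv_cancel_left G.inv_mult_group)
  have 1: "f (Tens (g \<otimes>\<^bsub>G\<^esub> x) (h \<otimes>\<^bsub>G\<^esub> y)) =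
      ?a \<otimes>\<^bsub>K\<^esub> f (Tens (?c (g \<otimes>\<^bsub>G\<^esub> h) x) (?c (g \<otimes>\<^bsub>G\<^esub> h) y)) \<otimes>\<^bsub>K\<^esub> (f (Tens g h) \<otimes>\<^bsub>K\<^esub> ?d)"
    using assms
    by (simp add: tens_mult_left[of g x "h \<otimes>\<^bsub>G\<^esub> y"] tens_mult_right[of g h y] cm
        tens_mult_right[of "?c g x" "?c g h" "?c g y"] cc)
  have 2: "f (Tens (g \<otimes>\<^bsub>G\<^esub> x) (h \<otimes>\<^bsub>G\<^esub> y)) =
      ?a \<otimes>\<^bsub>K\<^esub> f (Tens g h) \<otimes>\<^bsub>K\<^esub> (f (Tens (?c (h \<otimes>\<^bsub>G\<^esub> g) x) (?c (h \<otimes>\<^bsub>G\<^esub> g) y)) \<otimes>\<^bsub>K\<^esub> ?d)"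
    using assms
    by (simp add: tens_mult_right[of "g \<otimes>\<^bsub>G\<^esub> x" h y] tens_mult_left[of g x h] cm
        tens_mult_left[of "?c h g" "?c h x" "?c h y"] cc)
  show ?thesis
    using 1 2 assms by (simp add: K.m_assoc) (simp add: K.m_assoc[symmetric])
qed

lemma tens_conj:
  assumes g: "g \<in> carrier G" and h: "h \<in> carrier G" and x: "x \<in> carrier G" and y: "y \<in> carrier G"
  shows "f (Tens g h) \<otimes>\<^bsub>K\<^esub> f (Tens x y) \<otimes>\<^bsub>K\<^esub> inv\<^bsub>K\<^esub> f (Tens g h) =
    f (Tens (conj_by G (commutator G g h) x) (conj_by G (commutator G g h) y))"
proof -
  \<comment> \<open>Since \<open>gh = [g,h]hg\<close>, substituting the conjugates by \<open>(hg)\<^sup>-\<^sup>1\<close> in \<open>tens_swap\<close> leaves \<open>[g,h]\<close>.\<close>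
  let ?i = "inv\<^bsub>G\<^esub> (h \<otimes>\<^bsub>G\<^esub> g)"
  have 1: "conj_by G (g \<otimes>\<^bsub>G\<^esub> h) (conj_by G ?i u) = conj_by G (commutator G g h) u"
    "conj_by G (h \<otimes>\<^bsub>G\<^esub> g) (conj_by G ?i u) = u" if "u \<in> carrier G" for u
    using assms that
    by (simp_all add: conj_by_def commutator_def G.m_assoc G.inv_cancel_left G.inv_mult_group)
  have "f (Tens g h) \<otimes>\<^bsub>K\<^esub> f (Tens x y) =
    f (Tens (conj_by G (commutator G g h) x) (conj_by G (commutator G g h) y)) \<otimes>\<^bsub>K\<^esub> f (Tens g h)"
    using tens_swap[of g h "conj_by G ?i x" "conj_by G ?i y"] assms by (simp add: 1)
  then show ?thesis using assms by (simp add: K.m_assoc)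
qed

text \<open>An element \<open>t\<close> of a group receiving a pairing conjugates \<open>x \<and> y\<close> the way its image
  \<open>\<eta> t\<close> in \<open>G\<close> does. Only the generators need to be checked: \<open>{(g,g)}\<close> acts in this way by a
  defining relation and \<open>g \<otimes> h\<close> by \<open>tens_conj\<close>.\<close>
lemma word_conj:
  assumes w: "w \<in> words (qgens q G)" and x: "x \<in> carrier G" and y: "y \<in> carrier G"
  shows "word_val K f w \<otimes>\<^bsub>K\<^esub> f (Tens x y) \<otimes>\<^bsub>K\<^esub> inv\<^bsub>K\<^esub> word_val K f w =
    f (Tens (conj_by G (word_val G (eta_gen q G) w) x) (conj_by G (word_val G (eta_gen q G) w) y))"
  using w
proof (induction w)
  case Nil
  then show ?case using x y by (simp add: conj_by_def)
next
  case (Cons p w)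
  obtain a b where p: "p = (a, b)" by (cases p)
  let ?e = "eta_gen q G a" and ?v = "word_val K f w" and ?k = "word_val G (eta_gen q G) w"
  have a: "f a \<in> carrier K" "?e \<in> carrier G"
    using Cons.prems p f_closed G.eta_gen_closed[of q] by (auto dest: PiE simp del: eta_gen.simps)
  have v: "?v \<in> carrier K" "?k \<in> carrier G"
    using Cons.prems K.word_val_closed[OF f_closed] G.word_val_closed[OF G.eta_gen_closed] by auto
  have gen: "f a \<otimes>\<^bsub>K\<^esub> f (Tens s t) \<otimes>\<^bsub>K\<^esub> inv\<^bsub>K\<^esub> f a = f (Tens (conj_by G ?e s) (conj_by G ?e t))"
    if "s \<in> carrier G" "t \<in> carrier G" for s t
    using Cons.prems p that tens_conj diag_conj by (auto simp: qgens_def split: if_splits)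
  have cc: "conj_by G k (conj_by G l u) = conj_by G (k \<otimes>\<^bsub>G\<^esub> l) u"
    if "k \<in> carrier G" "u \<in> carrier G" "l \<in> carrier G" for k u l
    using that by (simp add: conj_by_def G.m_assoc G.inv_mult_group)
  have gen_inv: "inv\<^bsub>K\<^esub> f a \<otimes>\<^bsub>K\<^esub> f (Tens s t) \<otimes>\<^bsub>K\<^esub> f a =
      f (Tens (conj_by G (inv\<^bsub>G\<^esub> ?e) s) (conj_by G (inv\<^bsub>G\<^esub> ?e) t))"
    if st: "s \<in> carrier G" "t \<in> carrier G" for s t
  proof -
    have "f a \<otimes>\<^bsub>K\<^esub> f (Tens (conj_by G (inv\<^bsub>G\<^esub> ?e) s) (conj_by G (inv\<^bsub>G\<^esub> ?e) t)) \<otimes>\<^bsub>K\<^esub> inv\<^bsub>K\<^esub> f a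
        = f (Tens s t)"
      using gen[of "conj_by G (inv\<^bsub>G\<^esub> ?e) s" "conj_by G (inv\<^bsub>G\<^esub> ?e) t"] st a
      by (simp add: cc) (simp add: conj_by_def)
    from this[symmetric] show ?thesis using a st by (simp add: K.m_assoc K.inv_cancel_left)
  qed
  let ?l = "if b then f a else inv\<^bsub>K\<^esub> f a"
  have "word_val K f (p # w) \<otimes>\<^bsub>K\<^esub> f (Tens x y) \<otimes>\<^bsub>K\<^esub> inv\<^bsub>K\<^esub> word_val K f (p # w)
      = ?l \<otimes>\<^bsub>K\<^esub> (?v \<otimes>\<^bsub>K\<^esub> f (Tens x y) \<otimes>\<^bsub>K\<^esub> inv\<^bsub>K\<^esub> ?v) \<otimes>\<^bsub>K\<^esub> inv\<^bsub>K\<^esub> ?l"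
    using a v x y p by (simp add: K.m_assoc K.inv_mult_group)
  also have "\<dots> = ?l \<otimes>\<^bsub>K\<^esub> f (Tens (conj_by G ?k x) (conj_by G ?k y)) \<otimes>\<^bsub>K\<^esub> inv\<^bsub>K\<^esub> ?l"
    using Cons by simp
  also have "\<dots> = f (Tens (conj_by G (if b then ?e else inv\<^bsub>G\<^esub> ?e) (conj_by G ?k x))
      (conj_by G (if b then ?e else inv\<^bsub>G\<^esub> ?e) (conj_by G ?k y)))"
    using gen gen_inv v x y a by simp
  finally show ?case using v x y a p by (simp add: cc)
qed

text \<open>A symbol \<open>{(g,g)}\<close> with \<open>g\<^sup>q = 1\<close> is central: it conjugates the \<open>x \<otimes> y\<close> by \<open>g\<^sup>q = 1\<close>, and its
  commutator with \<open>{(x,x)}\<close> is \<open>x\<^sup>q \<otimes> g\<^sup>q = 1\<close>.\<close>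
lemma word_commutes_torsion_diag:
  assumes q: "q > 0" and w: "w \<in> words (qgens q G)"
    and g: "g \<in> carrier G" "g [^]\<^bsub>G\<^esub> q = \<one>\<^bsub>G\<^esub>"
  shows "word_val K f w \<otimes>\<^bsub>K\<^esub> f (Diag g) = f (Diag g) \<otimes>\<^bsub>K\<^esub> word_val K f w"
  using w
proof (induction w)
  case Nil
  then show ?case using g q by simp
next
  case (Cons p w)
  obtain a b where p: "p = (a, b)" by (cases p)
  let ?d = "f (Diag g)" and ?v = "word_val K f w"
  have a: "f a \<in> carrier K" and d: "?d \<in> carrier K"
    using Cons.prems p f_closed g q by auto
  have v: "?v \<in> carrier K"
    using Cons.prems K.word_val_closed[OF f_closed] by auto
  have 1: "f (Tens x y) \<otimes>\<^bsub>K\<^esub> ?d = ?d \<otimes>\<^bsub>K\<^esub> f (Tens x y)" if "x \<in> carrier G" "y \<in> carrier G" for x y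
    using diag_conj[OF q g(1) that] that g d
    by (simp add: conj_by_def) (metis K.inv_solve_right' K.m_closed tens_closed)
  have 2: "f (Diag x) \<otimes>\<^bsub>K\<^esub> ?d = ?d \<otimes>\<^bsub>K\<^esub> f (Diag x)" if "x \<in> carrier G" for x
  proof -
    have c: "f (Diag x) \<in> carrier K" using that q by simp
    have "f (Diag x) \<otimes>\<^bsub>K\<^esub> ?d \<otimes>\<^bsub>K\<^esub> inv\<^bsub>K\<^esub> (?d \<otimes>\<^bsub>K\<^esub> f (Diag x)) = \<one>\<^bsub>K\<^esub>"
      using diag_commutator[OF q that g(1)] that g d c
      by (simp add: commutator_def K.m_assoc K.inv_mult_group)
    then show ?thesis using c d
      by (metis K.inv_solve_right' K.l_one K.m_closed K.one_closed)
  qed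
  have "f a \<otimes>\<^bsub>K\<^esub> ?d = ?d \<otimes>\<^bsub>K\<^esub> f a"
    using Cons.prems p 1 2 by (auto simp: qgens_def split: if_splits)
  moreover from this have "inv\<^bsub>K\<^esub> f a \<otimes>\<^bsub>K\<^esub> ?d = ?d \<otimes>\<^bsub>K\<^esub> inv\<^bsub>K\<^esub> f a"
    using a d by (metis K.inv_solve_left K.inv_solve_right K.m_assoc K.m_closed K.inv_closed)
  ultimately obtain l where l: "l \<in> carrier K" "l \<otimes>\<^bsub>K\<^esub> ?d = ?d \<otimes>\<^bsub>K\<^esub> l"
    and w: "word_val K f (p # w) = l \<otimes>\<^bsub>K\<^esub> ?v"
    using a p by (cases b) auto
  have "l \<otimes>\<^bsub>K\<^esub> ?v \<otimes>\<^bsub>K\<^esub> ?d = l \<otimes>\<^bsub>K\<^esub> ?d \<otimes>\<^bsub>K\<^esub> ?v"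
    using Cons l(1) d v by (simp add: K.m_assoc)
  also have "\<dots> = ?d \<otimes>\<^bsub>K\<^esub> (l \<otimes>\<^bsub>K\<^esub> ?v)"
    using l(1) d v by (simp only: l(2) K.m_assoc)
  finally show ?case by (simp only: w)
qed

end

section \<open>The universal property of the q-exterior square\<close>

lemma ext_elt_closed: "w \<in> words (qgens q G) \<Longrightarrow> ext_elt q G w \<in> carrier (ext_square q G)"
  by (simp add: carrier_ext_square)

lemma ext_elt_cong: "word_eq (qgens q G) (qrels q G) u v \<Longrightarrow> ext_elt q G u = ext_elt q G v"
  by (simp add: ext_elt_def tensor_elt_def word_class_eq)

lemma ext_elt_Nil: "ext_elt q G [] = \<one>\<^bsub>ext_square q G\<^esub>"
proof -
  interpret E: group "ext_square q G" by (rule group_ext_square)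
  have "ext_elt q G [] \<otimes>\<^bsub>ext_square q G\<^esub> ext_elt q G [] = ext_elt q G []"
    by (simp add: ext_elt_mult)
  then show ?thesis using ext_elt_closed[of "[]" q G] by simp
qed

lemma ext_elt_inv:
  assumes "x \<in> qgens q G"
  shows "ext_elt q G [(x, False)] = inv\<^bsub>ext_square q G\<^esub> ext_elt q G [(x, True)]"
proof -
  interpret E: group "ext_square q G" by (rule group_ext_square)
  have "word_eq (qgens q G) (qrels q G) ([] @ [(x, False), (x, \<not> False)] @ []) ([] @ [])"
    by (rule word_eq.cancel) (use assms in auto)
  then have "ext_elt q G [(x, False)] \<otimes>\<^bsub>ext_square q G\<^esub> ext_elt q G [(x, True)] = \<one>\<^bsub>ext_square q G\<^esub>"
    using assms ext_elt_cong[of q G "[(x, False), (x, True)]" "[]"] by (simp add: ext_elt_mult ext_elt_Nil)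
  then show ?thesis using assms by (intro E.inv_equality[symmetric]) (simp_all add: ext_elt_closed)
qed

lemma word_val_ext_elt:
  assumes "w \<in> words (qgens q G)"
  shows "word_val (ext_square q G) (\<lambda>x. ext_elt q G [(x, True)]) w = ext_elt q G w"
proof -
  interpret E: group "ext_square q G" by (rule group_ext_square)
  show ?thesis
    using assms
  proof (induction w)
    case Nil
    then show ?case by (simp add: ext_elt_Nil)
  next
    case (Cons p w)
    then show ?case
      using ext_elt_mult[of "[p]" q G w] by (cases p) (auto simp: ext_elt_inv)
  qed
qed

text \<open>The pairing of \<open>G\<close> with its q-exterior square itself, through which all others factor.\<close>
lemma ext_pairing:
  assumes "group G"
  shows "q_pairing q G (ext_square q G) (\<lambda>x. ext_elt q G [(x, True)])"
proof -
  interpret G: group G by fact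
  interpret E: group "ext_square q G" by (rule group_ext_square)
  interpret T: group "tensor_square q G" by (rule group_tensor_square)
  interpret N: normal "ext_kernel q G" "tensor_square q G" by (rule ext_kernel_normal)
  show ?thesis
  proof
    show "(\<lambda>x. ext_elt q G [(x, True)]) \<in> qgens q G \<rightarrow> carrier (ext_square q G)"
      by (simp add: ext_elt_closed)
    fix r s assume rs: "(r, s) \<in> qrels q G"
    note w = qrels_in_words[OF assms rs]
    have "word_eq (qgens q G) (qrels q G) ([] @ r @ []) ([] @ s @ [])"
      by (rule word_eq.rel) (use rs w in auto)
    then show "word_val (ext_square q G) (\<lambda>x. ext_elt q G [(x, True)]) r =
        word_val (ext_square q G) (\<lambda>x. ext_elt q G [(x, True)]) s"
      using w by (simp add: word_val_ext_elt ext_elt_cong)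
  next
    fix g assume g: "g \<in> carrier G"
    let ?t = "tensor_elt q G (tens g g)"
    have t: "?t \<in> carrier (tensor_square q G)"
      unfolding tensor_elt_carrier using tens_in_words(1)[OF g g] by blast
    then have "conj_by (tensor_square q G) \<one>\<^bsub>tensor_square q G\<^esub> ?t = ?t"
      by (simp add: conj_by_def)
    then have "?t \<in> ext_kernel q G"
      unfolding ext_kernel_def normal_closure_def using g T.one_closed
      by (intro generate.incl) (smt (verit, best) mem_Collect_eq)
    then have "ext_kernel q G #>\<^bsub>tensor_square q G\<^esub> ?t = ext_kernel q G"
      using t T.coset_join2 N.subgroup_axioms by blast
    then show "ext_elt q G [(Tens g g, True)] = \<one>\<^bsub>ext_square q G\<^esub>"
      by (simp add: ext_elt_def ext_square_def FactGroup_def)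
  qed
qed

lemma q_pairing_hom:
  assumes "q_pairing q G K f" "group L" "h \<in> hom K L"
  shows "q_pairing q G L (h \<circ> f)"
proof -
  interpret q_pairing q G K f by fact
  interpret L: group L by fact
  show ?thesis
  proof
    show "h \<circ> f \<in> qgens q G \<rightarrow> carrier L"
      using f_closed assms(3) by (auto simp: hom_def)
    show "word_val L (h \<circ> f) r = word_val L (h \<circ> f) s" if "(r, s) \<in> qrels q G" for r s
      using f_rel[OF that] qrels_in_words[OF G.group_axioms that] assms
      by (simp add: word_val_hom[OF K.group_axioms _ _ f_closed])
    show "(h \<circ> f) (Tens g g) = \<one>\<^bsub>L\<^esub>" if "g \<in> carrier G" for g
      using f_alt[OF that] hom_one[OF assms(3) K.group_axioms assms(2)] by simp
  qed
qed

context q_pairing begin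

lemma tensor_val:
  assumes "w \<in> words (qgens q G)"
  shows "word_val K f (SOME v. v \<in> tensor_elt q G w) = word_val K f w"
proof -
  have "(SOME v. v \<in> tensor_elt q G w) \<in> tensor_elt q G w"
    using G.self_tensor_elt[OF assms] by (rule someI)
  then have "word_eq (qgens q G) (qrels q G) w (SOME v. v \<in> tensor_elt q G w)"
    by (simp add: tensor_elt_def word_class_def)
  then show ?thesis using K.word_val_eq[OF f_closed f_rel] by metis
qed

lemma ext_elt_eq_imp_word_val_eq:
  assumes u: "u \<in> words (qgens q G)" and v: "v \<in> words (qgens q G)"
    and eq: "ext_elt q G u = ext_elt q G v"
  shows "word_val K f u = word_val K f v"
proof -
  let ?T = "tensor_square q G"
  define e where "e t = word_val K f (SOME w. w \<in> t)" for t
  interpret T: group ?T by (rule group_tensor_square)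
  interpret N: normal "ext_kernel q G" ?T by (rule ext_kernel_normal)
  have e_elt: "e (tensor_elt q G w) = word_val K f w" if "w \<in> words (qgens q G)" for w
    using tensor_val[OF that] by (simp add: e_def)
  have "e \<in> hom ?T K"
    by (rule homI) (auto simp: tensor_elt_carrier G.tensor_elt_mult e_elt
        K.word_val_closed[OF f_closed] K.word_val_append[OF f_closed])
  then interpret e: group_hom ?T K e by unfold_locales
  have "ext_kernel q G \<subseteq> kernel ?T K e"
    unfolding ext_kernel_def normal_closure_def
  proof (rule T.generate_subgroup_incl[OF _ e.subgroup_kernel], clarify)
    fix t g assume t: "t \<in> carrier ?T" and g: "g \<in> carrier G"
    have c: "tensor_elt q G (tens g g) \<in> carrier ?T"
      unfolding tensor_elt_carrier using tens_in_words(1)[OF g g] by blast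
    have "e (tensor_elt q G (tens g g)) = \<one>\<^bsub>K\<^esub>"
      using e_elt[OF tens_in_words(1)[OF g g]] g by (simp add: f_alt)
    then show "conj_by ?T t (tensor_elt q G (tens g g)) \<in> kernel ?T K e"
      using t c by (simp add: kernel_def conj_by_def)
  qed
  moreover have "tensor_elt q G u \<in> ext_kernel q G #>\<^bsub>?T\<^esub> tensor_elt q G v"
    using eq u T.rcos_self[of "tensor_elt q G u" "ext_kernel q G"]
    by (simp add: ext_elt_def tensor_elt_carrier N.subgroup_axioms)
  then obtain n where n: "n \<in> ext_kernel q G" "tensor_elt q G u = n \<otimes>\<^bsub>?T\<^esub> tensor_elt q G v"
    by (auto simp: r_coset_def)
  ultimately have "e n = \<one>\<^bsub>K\<^esub>" "n \<in> carrier ?T" by (auto simp: kernel_def)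
  then have "e (tensor_elt q G u) = e (tensor_elt q G v)"
    using n v by (simp add: tensor_elt_carrier K.word_val_closed[OF f_closed] e_elt)
  then show ?thesis using u v by (simp add: e_elt)
qed

text \<open>The universal property: pairings on \<open>G\<close> are homomorphisms out of the q-exterior square.\<close>
lemma ext_square_lift:
  obtains h where "h \<in> hom (ext_square q G) K"
    and "\<And>w. w \<in> words (qgens q G) \<Longrightarrow> h (ext_elt q G w) = word_val K f w"
proof
  define h where "h c = word_val K f (SOME w. w \<in> words (qgens q G) \<and> c = ext_elt q G w)" for c
  show h: "h (ext_elt q G w) = word_val K f w" if w: "w \<in> words (qgens q G)" for w
  proof -
    have "\<exists>v. v \<in> words (qgens q G) \<and> ext_elt q G w = ext_elt q G v" using w by blast
    from someI_ex[OF this] show ?thesis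
      unfolding h_def by (intro ext_elt_eq_imp_word_val_eq[OF w, symmetric]) simp_all
  qed
  show "h \<in> hom (ext_square q G) K"
    by (rule homI) (auto simp: carrier_ext_square ext_elt_mult h
        K.word_val_closed[OF f_closed] K.word_val_append[OF f_closed])
qed

end

section \<open>The quotients that define the multipliers\<close>

text \<open>The set \<open>D\<close> covers both multipliers at once: \<open>D = {}\<close> yields \<open>M\<^sub>0\<^sup>q(G)\<close>, and all \<open>g\<close>
  with \<open>g\<^sup>q = 1\<close> yield the hatted version. For \<open>q = 0\<close> the symbols \<open>{(g,g)}\<close> do not exist
  and \<open>D\<close> is ignored.\<close>
definition bog_kernel :: "nat \<Rightarrow> ('a, 'b) monoid_scheme \<Rightarrow> 'a set \<Rightarrow> 'a qgen word set set set" where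
  "bog_kernel q G D = generate (ext_square q G)
    ({wedge q G x y | x y. x \<in> carrier G \<and> y \<in> carrier G \<and> commutator G x y = \<one>\<^bsub>G\<^esub>} \<union>
     (if q = 0 then {} else ext_diag q G ` D))"

definition bog_square :: "nat \<Rightarrow> ('a, 'b) monoid_scheme \<Rightarrow> 'a set \<Rightarrow> 'a qgen word set set set monoid" where
  "bog_square q G D = ext_square q G Mod bog_kernel q G D"

definition bog_elt :: "nat \<Rightarrow> ('a, 'b) monoid_scheme \<Rightarrow> 'a set \<Rightarrow> 'a qgen word \<Rightarrow> 'a qgen word set set set" where
  "bog_elt q G D w = bog_kernel q G D #>\<^bsub>ext_square q G\<^esub> ext_elt q G w"

locale torsion_group = group G for q :: nat and G :: "('a, 'c) monoid_scheme" (structure)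
    and D :: "'a set" +
  assumes D_torsion: "D \<subseteq> {g \<in> carrier G. g [^] q = \<one>}"
begin

sublocale E: group "ext_square q G" by (rule group_ext_square)

text \<open>The generators are permuted by conjugation: \<open>word_conj\<close> sends \<open>x \<and> y\<close> with \<open>[x,y] = 1\<close> to
  a wedge of conjugates, which commute as well, and the \<open>{(g,g)}\<close> with \<open>g\<close> in \<open>D\<close> are central by
  \<open>word_commutes_torsion_diag\<close>.\<close>
sublocale N: normal "bog_kernel q G D" "ext_square q G"
proof -
  let ?E = "ext_square q G"
  let ?S = "{wedge q G x y | x y. x \<in> carrier G \<and> y \<in> carrier G \<and> commutator G x y = \<one>} \<union>
     (if q = 0 then {} else ext_diag q G ` D)"
  interpret q_pairing q G ?E "\<lambda>x. ext_elt q G [(x, True)]" by (rule ext_pairing) (rule group_axioms)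
  have S: "?S \<subseteq> carrier ?E"
    using D_torsion by (auto simp: wedge_def ext_diag_def qgens_def intro!: ext_elt_closed)
  have in_S: "wedge q G x y \<in> ?S"
    if "x \<in> carrier G" "y \<in> carrier G" "commutator G x y = \<one>" for x y
    using that by auto
  have "t \<otimes>\<^bsub>?E\<^esub> s \<otimes>\<^bsub>?E\<^esub> inv\<^bsub>?E\<^esub> t \<in> ?S" if s: "s \<in> ?S" and t: "t \<in> carrier ?E" for s t
  proof -
    obtain w where w: "w \<in> words (qgens q G)" "t = ext_elt q G w"
      using t by (auto simp: carrier_ext_square)
    let ?k = "word_val G (eta_gen q G) w"
    have k: "?k \<in> carrier G" using word_val_closed[OF eta_gen_closed w(1)] .
    consider x y where "x \<in> carrier G" "y \<in> carrier G" "commutator G x y = \<one>" "s = wedge q G x y"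
      | g where "q > 0" "g \<in> D" "s = ext_diag q G g"
      using s by (auto split: if_splits)
    then show ?thesis
    proof cases
      case 1
      have "commutator G (conj_by G ?k x) (conj_by G ?k y) = \<one>"
        using 1 k by (simp add: eta_rel_tens(3))
      moreover have "t \<otimes>\<^bsub>?E\<^esub> s \<otimes>\<^bsub>?E\<^esub> inv\<^bsub>?E\<^esub> t = wedge q G (conj_by G ?k x) (conj_by G ?k y)"
        using word_conj[OF w(1) 1(1,2)] 1(4) w by (simp add: word_val_ext_elt wedge_def)
      ultimately show ?thesis by (simp only:) (rule in_S, use 1 k in simp_all)
    next
      case 2
      then have g: "g \<in> carrier G" "g [^] q = \<one>" using D_torsion by auto
      have "t \<otimes>\<^bsub>?E\<^esub> s = s \<otimes>\<^bsub>?E\<^esub> t"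
        using word_commutes_torsion_diag[OF 2(1) w(1) g] 2(3) w by (simp add: word_val_ext_elt ext_diag_def)
      then have "t \<otimes>\<^bsub>?E\<^esub> s \<otimes>\<^bsub>?E\<^esub> inv\<^bsub>?E\<^esub> t = s"
        using t subsetD[OF S s] by (simp add: E.m_assoc)
      then show ?thesis using s by simp
    qed
  qed
  then show "bog_kernel q G D \<lhd> ?E"
    unfolding bog_kernel_def using S by (intro E.normal_generateI) auto
qed

lemma group_bog_square: "group (bog_square q G D)"
  unfolding bog_square_def by (rule N.factorgroup_is_group)

lemma bog_hom: "(\<lambda>c. bog_kernel q G D #>\<^bsub>ext_square q G\<^esub> c) \<in> hom (ext_square q G) (bog_square q G D)"
  unfolding bog_square_def by (rule N.r_coset_hom_Mod)

lemma word_val_bog_elt: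
  assumes "w \<in> words (qgens q G)"
  shows "word_val (bog_square q G D) (\<lambda>x. bog_elt q G D [(x, True)]) w = bog_elt q G D w"
  using word_val_hom[OF E.group_axioms group_bog_square bog_hom _ assms, of "\<lambda>x. ext_elt q G [(x, True)]"]
    assms
  by (simp add: word_val_ext_elt o_def bog_elt_def ext_elt_closed)

lemma bog_pairing: "q_pairing q G (bog_square q G D) (\<lambda>x. bog_elt q G D [(x, True)])"
  using q_pairing_hom[OF ext_pairing[OF group_axioms] group_bog_square bog_hom]
  by (simp add: o_def bog_elt_def)

lemma bog_elt_eq_one_iff:
  assumes "w \<in> words (qgens q G)"
  shows "bog_elt q G D w = \<one>\<^bsub>bog_square q G D\<^esub> \<longleftrightarrow> ext_elt q G w \<in> bog_kernel q G D"
  using E.coset_join1[OF _ _ N.subgroup_axioms] E.coset_join2[OF _ N.subgroup_axioms]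
    ext_elt_closed[OF assms] N.subset
  by (auto simp: bog_elt_def bog_square_def FactGroup_def)

lemma bog_elt_commuting:
  assumes "x \<in> carrier G" "y \<in> carrier G" "commutator G x y = \<one>"
  shows "bog_elt q G D (tens x y) = \<one>\<^bsub>bog_square q G D\<^esub>"
  using assms tens_in_words(1)[of x G y q]
  by (subst bog_elt_eq_one_iff) (auto simp: bog_kernel_def wedge_def intro!: generate.incl)

lemma bog_elt_torsion:
  assumes "q > 0" "g \<in> D"
  shows "bog_elt q G D (diag g) = \<one>\<^bsub>bog_square q G D\<^esub>"
  using assms tens_in_words(2)[of g G q] D_torsion
  by (subst bog_elt_eq_one_iff) (auto simp: bog_kernel_def ext_diag_def intro!: generate.incl)

lemma bog_elt_mult:
  assumes "u \<in> words (qgens q G)" "v \<in> words (qgens q G)"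
  shows "bog_elt q G D u \<otimes>\<^bsub>bog_square q G D\<^esub> bog_elt q G D v = bog_elt q G D (u @ v)"
  using assms hom_mult[OF bog_hom, of "ext_elt q G u" "ext_elt q G v"]
  by (simp add: bog_elt_def ext_elt_mult ext_elt_closed)

text \<open>Universal property of the quotient by \<open>bog_kernel\<close>, in a form that speaks of words only.\<close>
lemma bog_elt_lift:
  assumes "q_pairing q G K f"
    and comm: "\<And>x y. x \<in> carrier G \<Longrightarrow> y \<in> carrier G \<Longrightarrow> commutator G x y = \<one> \<Longrightarrow>
      f (Tens x y) = \<one>\<^bsub>K\<^esub>"
    and tors: "\<And>g. q > 0 \<Longrightarrow> g \<in> D \<Longrightarrow> f (Diag g) = \<one>\<^bsub>K\<^esub>"
    and u: "u \<in> words (qgens q G)" and v: "v \<in> words (qgens q G)"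
    and eq: "bog_elt q G D u = bog_elt q G D v"
  shows "word_val K f u = word_val K f v"
proof -
  let ?E = "ext_square q G"
  interpret q_pairing q G K f by fact
  obtain h where h: "h \<in> hom ?E K" and hw: "\<And>w. w \<in> words (qgens q G) \<Longrightarrow> h (ext_elt q G w) = word_val K f w"
    using ext_square_lift by blast
  interpret h: group_hom ?E K h using h by unfold_locales
  have "bog_kernel q G D \<subseteq> kernel ?E K h"
    unfolding bog_kernel_def
  proof (rule E.generate_subgroup_incl[OF _ h.subgroup_kernel])
    have "wedge q G x y \<in> kernel ?E K h"
      if "x \<in> carrier G" "y \<in> carrier G" "commutator G x y = \<one>" for x y
      using tens_in_words(1)[OF that(1,2), of q] comm[OF that] 
      by (simp add: kernel_def wedge_def hw ext_elt_closed)
    moreover have "ext_diag q G g \<in> kernel ?E K h" if "q > 0" "g \<in> D" for g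
      using tens_in_words(2)[of g G q] tors[OF that] that D_torsion
      by (auto simp: kernel_def ext_diag_def hw ext_elt_closed)
    ultimately show "{wedge q G x y | x y. x \<in> carrier G \<and> y \<in> carrier G \<and> commutator G x y = \<one>} \<union>
     (if q = 0 then {} else ext_diag q G ` D) \<subseteq> kernel ?E K h" by auto
  qed
  moreover have "ext_elt q G u \<in> bog_kernel q G D #>\<^bsub>?E\<^esub> ext_elt q G v"
    using E.rcos_self[OF ext_elt_closed[OF u] N.subgroup_axioms] eq by (simp add: bog_elt_def)
  then obtain n where n: "n \<in> bog_kernel q G D" "ext_elt q G u = n \<otimes>\<^bsub>?E\<^esub> ext_elt q G v"
    by (auto simp: r_coset_def)
  ultimately have "h n = \<one>\<^bsub>K\<^esub>" "n \<in> carrier ?E" by (auto simp: kernel_def)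
  then have "h (ext_elt q G u) = h (ext_elt q G v)"
    using n v by (simp add: ext_elt_closed)
  then show ?thesis using u v by (simp add: hw)
qed

end

section \<open>Transport of pairings along homomorphisms modulo a kernel\<close>

lemma (in group_hom) hom_conj_by:
  "x \<in> carrier G \<Longrightarrow> y \<in> carrier G \<Longrightarrow> h (conj_by G x y) = conj_by H (h x) (h y)"
  by (simp add: conj_by_def)

lemma (in group_hom) hom_commutator:
  "x \<in> carrier G \<Longrightarrow> y \<in> carrier G \<Longrightarrow> h (commutator G x y) = commutator H (h x) (h y)"
  by (simp add: commutator_def)

lemma word_val_cong:
  "w \<in> words S \<Longrightarrow> (\<And>x. x \<in> S \<Longrightarrow> f x = f' x) \<Longrightarrow> word_val K f w = word_val K f' w"
  by (induction w) (auto simp: word_val_def)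

text \<open>The map on words induced by a map of groups that is not assumed to be a homomorphism; it is the
  form in which the isomorphism of multipliers is given.\<close>
definition rename :: "('a \<Rightarrow> 'b) \<Rightarrow> 'a qgen word \<Rightarrow> 'b qgen word" where
  "rename \<sigma> = map (map_prod (map_qgen \<sigma>) id)"

lemma rename_append: "rename \<sigma> (u @ v) = rename \<sigma> u @ rename \<sigma> v"
  by (simp add: rename_def)

lemma rename_comp: "rename \<tau> (rename \<sigma> w) = rename (\<tau> \<circ> \<sigma>) w"
  by (induction w) (auto simp: rename_def qgen.map_comp o_def)

lemma rename_words:
  "\<sigma> \<in> carrier G \<rightarrow> carrier H \<Longrightarrow> w \<in> words (qgens q G) \<Longrightarrow> rename \<sigma> w \<in> words (qgens q H)"
  by (induction w) (auto simp: rename_def qgens_def split: if_splits)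

lemma word_val_rename: "word_val K f (rename \<sigma> w) = word_val K (f \<circ> map_qgen \<sigma>) w"
  by (induction w) (auto simp: rename_def word_val_def)

text \<open>The maps \<open>\<alpha>\<close> and \<open>\<pi>\<close> express that \<open>\<sigma>\<close> is a homomorphism modulo the kernel of \<open>\<pi>\<close>. Every
  relation of \<open>G\<close> is carried by \<open>\<sigma>\<close> to a relation of \<open>H\<close> up to factors in this kernel, and a pairing
  that does not see such factors turns it into an equality.\<close>
lemma q_pairing_transport:
  assumes "group G" "q_pairing q H K f" "group Q" "\<alpha> \<in> hom G Q" "\<pi> \<in> hom H Q"
    and \<sigma>: "\<And>g. g \<in> carrier G \<Longrightarrow> \<sigma> g \<in> carrier H"
    and lift: "\<And>g. g \<in> carrier G \<Longrightarrow> \<pi> (\<sigma> g) = \<alpha> g"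
    and tens: "\<And>x x' y y'. x \<in> carrier H \<Longrightarrow> x' \<in> carrier H \<Longrightarrow> y \<in> carrier H \<Longrightarrow> y' \<in> carrier H \<Longrightarrow>
      \<pi> x = \<pi> x' \<Longrightarrow> \<pi> y = \<pi> y' \<Longrightarrow> f (Tens x y) = f (Tens x' y')"
    and diag: "\<And>x x'. q > 0 \<Longrightarrow> x \<in> carrier H \<Longrightarrow> x' \<in> carrier H \<Longrightarrow> \<pi> x = \<pi> x' \<Longrightarrow>
      f (Diag x) = f (Diag x')"
  shows "q_pairing q G K (f \<circ> map_qgen \<sigma>)"
proof -
  interpret G: group G by fact
  interpret H: q_pairing q H K f by fact
  interpret \<alpha>: group_hom G Q \<alpha> using assms by (simp add: group_hom_def group_hom_axioms_def)
  interpret \<pi>: group_hom H Q \<pi>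
    using assms H.G.group_axioms by (simp add: group_hom_def group_hom_axioms_def)
  let ?f = "f \<circ> map_qgen \<sigma>"
  note mult = \<pi>.hom_mult \<alpha>.hom_mult and hom = \<pi>.hom_conj_by \<alpha>.hom_conj_by \<pi>.hom_nat_pow \<alpha>.hom_nat_pow
    \<pi>.hom_int_pow \<alpha>.hom_int_pow \<pi>.hom_inv \<alpha>.hom_inv \<pi>.hom_commutator \<alpha>.hom_commutator
  \<comment> \<open>The facts 1 to 6 are the families of relations in the order of \<open>tensor_rels\<close> and \<open>diag_rels\<close>.\<close>
  have 1: "word_val K ?f (tens (g \<otimes>\<^bsub>G\<^esub> g1) h) =
      word_val K ?f (tens (conj_by G g g1) (conj_by G g h) @ tens g h)"
    if "g \<in> carrier G" "g1 \<in> carrier G" "h \<in> carrier G" for g g1 h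
  proof -
    have "f (Tens (\<sigma> (g \<otimes>\<^bsub>G\<^esub> g1)) (\<sigma> h)) = f (Tens (\<sigma> g \<otimes>\<^bsub>H\<^esub> \<sigma> g1) (\<sigma> h))"
      by (rule tens) (use that in \<open>simp_all add: \<sigma> lift\<close>)
    moreover have "f (Tens (\<sigma> (conj_by G g g1)) (\<sigma> (conj_by G g h))) =
        f (Tens (conj_by H (\<sigma> g) (\<sigma> g1)) (conj_by H (\<sigma> g) (\<sigma> h)))"
      by (rule tens) (use that in \<open>simp_all add: \<sigma> lift hom\<close>)
    ultimately show ?thesis using that by (simp add: \<sigma> H.tens_mult_left)
  qed
  have 2: "word_val K ?f (tens g (h \<otimes>\<^bsub>G\<^esub> h1)) =
      word_val K ?f (tens g h @ tens (conj_by G h g) (conj_by G h h1))"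
    if "g \<in> carrier G" "h \<in> carrier G" "h1 \<in> carrier G" for g h h1
  proof -
    have "f (Tens (\<sigma> g) (\<sigma> (h \<otimes>\<^bsub>G\<^esub> h1))) = f (Tens (\<sigma> g) (\<sigma> h \<otimes>\<^bsub>H\<^esub> \<sigma> h1))"
      by (rule tens) (use that in \<open>simp_all add: \<sigma> lift\<close>)
    moreover have "f (Tens (\<sigma> (conj_by G h g)) (\<sigma> (conj_by G h h1))) =
        f (Tens (conj_by H (\<sigma> h) (\<sigma> g)) (conj_by H (\<sigma> h) (\<sigma> h1)))"
      by (rule tens) (use that in \<open>simp_all add: \<sigma> lift hom\<close>)
    ultimately show ?thesis using that by (simp add: \<sigma> H.tens_mult_right)
  qed
  have 3: "word_val K ?f (diag g @ tens g1 h1 @ word_inv (diag g)) =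
      word_val K ?f (tens (conj_by G (g [^]\<^bsub>G\<^esub> q) g1) (conj_by G (g [^]\<^bsub>G\<^esub> q) h1))"
    if "q > 0" "g \<in> carrier G" "g1 \<in> carrier G" "h1 \<in> carrier G" for g g1 h1
  proof -
    have "f (Tens (\<sigma> (conj_by G (g [^]\<^bsub>G\<^esub> q) g1)) (\<sigma> (conj_by G (g [^]\<^bsub>G\<^esub> q) h1))) =
        f (Tens (conj_by H (\<sigma> g [^]\<^bsub>H\<^esub> q) (\<sigma> g1)) (conj_by H (\<sigma> g [^]\<^bsub>H\<^esub> q) (\<sigma> h1)))"
      by (rule tens) (use that in \<open>simp_all add: \<sigma> lift hom\<close>)
    then show ?thesis
      using that H.diag_conj[of "\<sigma> g" "\<sigma> g1" "\<sigma> h1"] by (simp add: \<sigma> word_inv_def H.K.m_assoc)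
  qed
  have 4: "word_val K ?f (diag (g \<otimes>\<^bsub>G\<^esub> x)) = word_val K ?f (diag g @
      concat (map (\<lambda>i. tens (inv\<^bsub>G\<^esub> g)
         (conj_by G (g [^]\<^bsub>G\<^esub> (1 - int q + int i)) x [^]\<^bsub>G\<^esub> i)) [1..<q]) @ diag x)"
    (is "_ = word_val K ?f (_ @ ?W @ _)")
    if q: "q > 0" and g: "g \<in> carrier G" "x \<in> carrier G" for g x
  proof -
    have "f (Diag (\<sigma> (g \<otimes>\<^bsub>G\<^esub> x))) = f (Diag (\<sigma> g \<otimes>\<^bsub>H\<^esub> \<sigma> x))"
      by (rule diag) (use q g in \<open>simp_all add: \<sigma> lift\<close>)
    also have "\<dots> = f (Diag (\<sigma> g)) \<otimes>\<^bsub>K\<^esub> word_val K f (H.correction_word (\<sigma> g) (\<sigma> x)) \<otimes>\<^bsub>K\<^esub> f (Diag (\<sigma> x))"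
      using q g by (simp add: H.diag_mult \<sigma>)
    also have "word_val K f (H.correction_word (\<sigma> g) (\<sigma> x)) = word_val K ?f ?W"
    proof (rule H.K.word_val_concat_cong)
      fix i
      have "f (Tens (inv\<^bsub>H\<^esub> \<sigma> g) (conj_by H (\<sigma> g [^]\<^bsub>H\<^esub> (1 - int q + int i)) (\<sigma> x) [^]\<^bsub>H\<^esub> i)) =
         f (Tens (\<sigma> (inv\<^bsub>G\<^esub> g)) (\<sigma> (conj_by G (g [^]\<^bsub>G\<^esub> (1 - int q + int i)) x [^]\<^bsub>G\<^esub> i)))"
        by (rule tens) (use g in \<open>simp_all add: \<sigma> lift hom\<close>)
      then show "f (Tens (inv\<^bsub>H\<^esub> \<sigma> g) (conj_by H (\<sigma> g [^]\<^bsub>H\<^esub> (1 - int q + int i)) (\<sigma> x) [^]\<^bsub>H\<^esub> i)) =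
         ?f (Tens (inv\<^bsub>G\<^esub> g) (conj_by G (g [^]\<^bsub>G\<^esub> (1 - int q + int i)) x [^]\<^bsub>G\<^esub> i))"
        by simp
    qed
    finally have m: "f (Diag (\<sigma> (g \<otimes>\<^bsub>G\<^esub> x))) = f (Diag (\<sigma> g)) \<otimes>\<^bsub>K\<^esub> word_val K ?f ?W \<otimes>\<^bsub>K\<^esub> f (Diag (\<sigma> x))" .
    have f: "?f \<in> qgens q G \<rightarrow> carrier K"
      by (auto simp: qgens_def \<sigma>)
    have W: "?W \<in> words (qgens q G)" using g by (auto simp: words_def qgens_def)
    have "diag x \<in> words (qgens q G)" using g q by (intro tens_in_words)
    with W have "word_val K ?f (?W @ diag x) = word_val K ?f ?W \<otimes>\<^bsub>K\<^esub> f (Diag (\<sigma> x))"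
      using g q by (subst H.K.word_val_append[OF f]) (simp_all add: \<sigma>)
    then show ?thesis
      using m H.K.word_val_closed[OF f W] g q
      by (simp add: \<sigma> H.K.m_assoc)
  qed
  have 5: "word_val K ?f (diag g @ diag g1 @ word_inv (diag g) @ word_inv (diag g1)) =
      word_val K ?f (tens (g [^]\<^bsub>G\<^esub> q) (g1 [^]\<^bsub>G\<^esub> q))"
    if "q > 0" "g \<in> carrier G" "g1 \<in> carrier G" for g g1
  proof -
    have "f (Tens (\<sigma> (g [^]\<^bsub>G\<^esub> q)) (\<sigma> (g1 [^]\<^bsub>G\<^esub> q))) = f (Tens (\<sigma> g [^]\<^bsub>H\<^esub> q) (\<sigma> g1 [^]\<^bsub>H\<^esub> q))"
      by (rule tens) (use that in \<open>simp_all add: \<sigma> lift hom\<close>)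
    then show ?thesis
      using that H.diag_commutator[of "\<sigma> g" "\<sigma> g1"]
      by (simp add: \<sigma> word_inv_def commutator_def H.K.m_assoc)
  qed
  have 6: "word_val K ?f (diag (commutator G g h)) = word_val K ?f (concat (replicate q (tens g h)))"
    if "q > 0" "g \<in> carrier G" "h \<in> carrier G" for g h
  proof -
    have "f (Diag (\<sigma> (commutator G g h))) = f (Diag (commutator H (\<sigma> g) (\<sigma> h)))"
      by (rule diag) (use that in \<open>simp_all add: \<sigma> lift hom\<close>)
    then show ?thesis
      using that H.K.word_val_concat_replicate[of ?f g h q] H.diag_of_commutator[of "\<sigma> g" "\<sigma> h"]
      by (simp add: \<sigma>)
  qed
  show ?thesis
  proof
    show "?f \<in> qgens q G \<rightarrow> carrier K" by (auto simp: qgens_def \<sigma>)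
    show "?f (Tens g g) = \<one>\<^bsub>K\<^esub>" if "g \<in> carrier G" for g
      using that by (simp add: \<sigma> H.f_alt)
    fix r s assume rs: "(r, s) \<in> qrels q G"
    show "word_val K ?f r = word_val K ?f s"
    proof (cases "(r, s) \<in> tensor_rels G")
      case True
      then show ?thesis unfolding tensor_rels_def
        by (elim UnE CollectE exE conjE; simp only: prod.inject; elim conjE) (simp_all only: 1 2)
    next
      case False
      then have D: "(r, s) \<in> diag_rels q G" and q: "q > 0"
        using rs by (simp_all add: qrels_def split: if_splits)
      show ?thesis using D unfolding diag_rels_def
        by (elim UnE CollectE exE conjE; simp only: prod.inject; elim conjE)
          (simp_all only: 3[OF q] 4[OF q] 5[OF q] 6[OF q])
    qed
  qed
qed

section \<open>Factors from a central subgroup\<close>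

context group begin

lemma center_commutator:
  assumes "z \<in> center G" "y \<in> carrier G"
  shows "commutator G z y = \<one>" "commutator G y z = \<one>"
  using assms by (auto simp: center_def commutator_def m_assoc inv_cancel_left)

lemma center_conj_by:
  assumes "z \<in> center G" "y \<in> carrier G"
  shows "conj_by G y z = z"
proof -
  have "z \<otimes> y = y \<otimes> z" "z \<in> carrier G" using assms by (auto simp: center_def)
  then show ?thesis using assms by (simp add: conj_by_def flip: \<open>z \<otimes> y = y \<otimes> z\<close>) (simp add: m_assoc)
qed

lemma central_subgroup_normal:
  assumes "subgroup Z G" "Z \<subseteq> center G"
  shows "Z \<lhd> G"
proof (rule normal_invI[OF assms(1)])
  show "x \<otimes> h \<otimes> inv x \<in> Z" if "x \<in> carrier G" "h \<in> Z" for x h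
    using center_conj_by[of h x] that assms by (auto simp: conj_by_def)
qed

lemma rcos_eq_central_translate:
  assumes "subgroup Z G" "Z \<subseteq> center G" "x \<in> carrier G" "y \<in> carrier G" "Z #> x = Z #> y"
  obtains z where "z \<in> Z" "y = x \<otimes> z"
proof -
  have "y \<in> Z #> x" using assms rcos_self by blast
  then show thesis using assms that by (force simp: r_coset_def center_def)
qed

lemma center_subgroup: "subgroup (center G) G"
proof (rule subgroupI)
  show "center G \<subseteq> carrier G" "center G \<noteq> {}" by (auto simp: center_def)
  fix a b assume a: "a \<in> center G" and b: "b \<in> center G"
  have c: "a \<in> carrier G" "b \<in> carrier G" using a b by (auto simp: center_def)
  have ac: "a \<otimes> g = g \<otimes> a" and bc: "b \<otimes> g = g \<otimes> b" if "g \<in> carrier G" for g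
    using a b that by (auto simp: center_def)
  have "inv a \<otimes> g = g \<otimes> inv a" if g: "g \<in> carrier G" for g
  proof -
    have "inv a \<otimes> g = inv a \<otimes> (g \<otimes> a) \<otimes> inv a" using c g by (simp add: m_assoc)
    also have "\<dots> = g \<otimes> inv a" using c g by (simp add: inv_cancel_left flip: ac[OF g])
    finally show ?thesis .
  qed
  then show "inv a \<in> center G" using c by (simp add: center_def)
  have "a \<otimes> b \<otimes> g = g \<otimes> (a \<otimes> b)" if g: "g \<in> carrier G" for g
  proof -
    have "a \<otimes> b \<otimes> g = a \<otimes> g \<otimes> b" using c g by (simp add: m_assoc bc)
    then show ?thesis using c g by (simp add: ac m_assoc)
  qed
  then show "a \<otimes> b \<in> center G" using c by (simp add: center_def)
qed

lemma center_nat_pow: "z \<in> center G \<Longrightarrow> z [^] (n::nat) \<in> center G"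
  by (induction n)
    (auto intro: subgroup.one_closed[OF center_subgroup] subgroup.m_closed[OF center_subgroup])

end

text \<open>For central \<open>z\<close> the correction factors \<open>x\<^sup>-\<^sup>1 \<otimes> z\<^sup>i\<close> in the product rule for \<open>{(xz,xz)}\<close>
  are pairings of commuting elements.\<close>
lemma (in q_pairing) diag_mult_center:
  assumes comm: "\<And>x y. x \<in> carrier G \<Longrightarrow> y \<in> carrier G \<Longrightarrow> commutator G x y = \<one>\<^bsub>G\<^esub> \<Longrightarrow>
      f (Tens x y) = \<one>\<^bsub>K\<^esub>"
    and q: "q > 0" and x: "x \<in> carrier G" and z: "z \<in> center G"
  shows "f (Diag (x \<otimes>\<^bsub>G\<^esub> z)) = f (Diag x) \<otimes>\<^bsub>K\<^esub> f (Diag z)"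
proof -
  have zc: "z \<in> carrier G" using z by (simp add: center_def)
  have "f (Tens (inv\<^bsub>G\<^esub> x) (conj_by G (x [^]\<^bsub>G\<^esub> (k::int)) z [^]\<^bsub>G\<^esub> i)) = \<one>\<^bsub>K\<^esub>" for k and i :: nat
    using x zc z G.center_nat_pow[OF z] by (intro comm) (simp_all add: G.center_conj_by G.center_commutator)
  then have "word_val K f (correction_word x z) = word_val K (\<lambda>_. \<one>\<^bsub>K\<^esub>) (correction_word x z)"
    by (intro K.word_val_concat_cong) simp
  also have "word_val K (\<lambda>_. \<one>\<^bsub>K\<^esub>) w = \<one>\<^bsub>K\<^esub>" for w :: "'a qgen word"
    by (induction w) auto
  finally show ?thesis using diag_mult[OF q x zc] q x zc by simp
qed

text \<open>The hypotheses on \<open>Z\<close> are what makes classes modulo \<open>bog_kernel\<close> insensitive to factors from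
  \<open>Z\<close>; both \<open>Z\<^sub>q(G)\<close> and its hatted version satisfy them for the appropriate \<open>D\<close>.\<close>
locale central_group = torsion_group q G D
  for q :: nat and G :: "('a, 'c) monoid_scheme" (structure) and D :: "'a set" +
  fixes Z :: "'a set"
  assumes Z_subgroup: "subgroup Z G" and Z_central: "Z \<subseteq> center G"
    and Z_diag: "q > 0 \<Longrightarrow> z \<in> Z \<Longrightarrow> ext_diag q G z \<in> bog_kernel q G D"
begin

sublocale Z: normal Z G
  by (rule central_subgroup_normal[OF Z_subgroup Z_central])

lemma bog_elt_tens_cong:
  assumes x: "x \<in> carrier G" "x' \<in> carrier G" and y: "y \<in> carrier G" "y' \<in> carrier G"
    and eq: "Z #> x = Z #> x'" "Z #> y = Z #> y'"
  shows "bog_elt q G D (tens x y) = bog_elt q G D (tens x' y')"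
proof -
  interpret q_pairing q G "bog_square q G D" "\<lambda>x. bog_elt q G D [(x, True)]" by (rule bog_pairing)
  have 0: "bog_elt q G D (tens z t) = \<one>\<^bsub>bog_square q G D\<^esub>"
    "bog_elt q G D (tens t z) = \<one>\<^bsub>bog_square q G D\<^esub>" "conj_by G t z = z"
    if "z \<in> Z" "t \<in> carrier G" for z t
    using that Z_central center_commutator[of z t] center_conj_by[of z t]
      bog_elt_commuting[of z t] bog_elt_commuting[of t z] by auto
  obtain z where z: "z \<in> Z" "x' = x \<otimes> z"
    using rcos_eq_central_translate[OF Z_subgroup Z_central x eq(1)] .
  obtain w where w: "w \<in> Z" "y' = y \<otimes> w"
    using rcos_eq_central_translate[OF Z_subgroup Z_central y eq(2)] .
  have "bog_elt q G D (tens x' y') = bog_elt q G D (tens x y')"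
    using z 0[OF z(1)] x y by (simp add: tens_mult_left)
  also have "\<dots> = bog_elt q G D (tens x y)"
    using w 0[OF w(1)] x y by (simp add: tens_mult_right)
  finally show ?thesis by simp
qed

lemma bog_elt_diag_cong:
  assumes q: "q > 0" and x: "x \<in> carrier G" "x' \<in> carrier G" and eq: "Z #> x = Z #> x'"
  shows "bog_elt q G D (diag x) = bog_elt q G D (diag x')"
proof -
  interpret q_pairing q G "bog_square q G D" "\<lambda>x. bog_elt q G D [(x, True)]" by (rule bog_pairing)
  obtain z where z: "z \<in> Z" "x' = x \<otimes> z"
    using rcos_eq_central_translate[OF Z_subgroup Z_central x eq] .
  have "bog_elt q G D (diag z) = \<one>\<^bsub>bog_square q G D\<^esub>"
    using Z_diag[OF q z(1)] tens_in_words(2)[of z G q] z q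
    by (subst bog_elt_eq_one_iff) (auto simp: ext_diag_def)
  moreover have "z \<in> center G" using z Z_central by blast
  then have "bog_elt q G D (diag (x \<otimes> z)) =
      bog_elt q G D (diag x) \<otimes>\<^bsub>bog_square q G D\<^esub> bog_elt q G D (diag z)"
    by (intro diag_mult_center bog_elt_commuting q x(1))
  ultimately show ?thesis using z q x by simp
qed

end

text \<open>Renaming along \<open>\<sigma>\<close> respects equality of classes: composing the quotient pairing of \<open>H\<close> with \<open>\<sigma>\<close>
  gives a pairing of \<open>G\<close> by \<open>q_pairing_transport\<close>, and it kills the generators of \<open>bog_kernel\<close>
  because \<open>\<sigma>\<close> preserves commuting pairs and the set \<open>D\<close>.\<close>
lemma rename_bog_elt_cong:
  assumes "central_group q G D Z" "central_group q H E W" "\<alpha> \<in> hom (G Mod Z) (H Mod W)"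
    and \<sigma>: "\<And>g. g \<in> carrier G \<Longrightarrow> \<sigma> g \<in> carrier H"
    and lift: "\<And>g. g \<in> carrier G \<Longrightarrow> \<alpha> (Z #>\<^bsub>G\<^esub> g) = W #>\<^bsub>H\<^esub> \<sigma> g"
    and comm: "\<And>x y. x \<in> carrier G \<Longrightarrow> y \<in> carrier G \<Longrightarrow> commutator G x y = \<one>\<^bsub>G\<^esub> \<Longrightarrow>
      commutator H (\<sigma> x) (\<sigma> y) = \<one>\<^bsub>H\<^esub>"
    and tors: "\<And>g. g \<in> D \<Longrightarrow> \<sigma> g \<in> E"
    and u: "u \<in> words (qgens q G)" and v: "v \<in> words (qgens q G)"
    and eq: "bog_elt q G D u = bog_elt q G D v"
  shows "bog_elt q H E (rename \<sigma> u) = bog_elt q H E (rename \<sigma> v)"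
proof -
  interpret G: central_group q G D Z by fact
  interpret H: central_group q H E W by fact
  let ?K = "bog_square q H E" and ?f = "(\<lambda>x. bog_elt q H E [(x, True)]) \<circ> map_qgen \<sigma>"
  have "(\<lambda>g. \<alpha> (Z #>\<^bsub>G\<^esub> g)) \<in> hom G (H Mod W)"
    using Group.hom_compose[OF G.Z.r_coset_hom_Mod assms(3)] by (simp add: o_def)
  then have pairing: "q_pairing q G ?K ?f"
    by (rule q_pairing_transport[OF G.group_axioms H.bog_pairing H.Z.factorgroup_is_group _
          H.Z.r_coset_hom_Mod])
      (assumption | rule \<sigma> lift[symmetric] H.bog_elt_tens_cong H.bog_elt_diag_cong)+
  have "word_val ?K ?f u = word_val ?K ?f v"
    by (rule G.bog_elt_lift[OF pairing _ _ u v eq])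
      (simp_all add: \<sigma> comm tors H.bog_elt_commuting H.bog_elt_torsion)
  moreover have "word_val ?K ?f w = bog_elt q H E (rename \<sigma> w)" if "w \<in> words (qgens q G)" for w
    using H.word_val_bog_elt[OF rename_words[OF _ that, of \<sigma> H]] \<sigma> by (simp add: word_val_rename)
  ultimately show ?thesis using u v by simp
qed

section \<open>Multipliers of isoclinic groups\<close>

definition bog_multiplier ::
  "nat \<Rightarrow> ('a, 'b) monoid_scheme \<Rightarrow> 'a set \<Rightarrow> 'a qgen word set set set monoid" where
  "bog_multiplier q G D = (ext_square q G)\<lparr>carrier := Mq q G\<rparr> Mod bog_kernel q G D"

context torsion_group begin

lemma bog_multiplier_carrier:
  "carrier (bog_multiplier q G D) =
    {bog_elt q G D w | w. w \<in> words (qgens q G) \<and> word_val G (eta_gen q G) w = \<one>}"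
proof -
  have "Mq q G = {ext_elt q G w | w. w \<in> words (qgens q G) \<and> word_val G (eta_gen q G) w = \<one>}"
    unfolding Mq_def kernel_def carrier_ext_square by (auto simp: eta_ext_elt)
  then show ?thesis
    unfolding bog_multiplier_def FactGroup_def RCOSETS_def bog_elt_def r_coset_def by auto
qed

lemma bog_multiplier_mult:
  assumes "u \<in> words (qgens q G)" "v \<in> words (qgens q G)"
  shows "bog_elt q G D u \<otimes>\<^bsub>bog_multiplier q G D\<^esub> bog_elt q G D v = bog_elt q G D (u @ v)"
  using bog_elt_mult[OF assms]
  by (simp add: bog_multiplier_def bog_square_def FactGroup_def set_mult_def)

end

text \<open>The pairs of isomorphisms whose existence \<open>isoclinic_mod\<close> asserts, made explicit so that
  they can be inverted.\<close>
definition isoclinism ::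
  "nat \<Rightarrow> ('a, 'c) monoid_scheme \<Rightarrow> 'a set \<Rightarrow> ('b, 'd) monoid_scheme \<Rightarrow> 'b set \<Rightarrow>
    ('a set \<Rightarrow> 'b set) \<Rightarrow> ('a \<Rightarrow> 'b) \<Rightarrow> bool" where
  "isoclinism q G Z H W \<alpha> \<beta> \<longleftrightarrow>
    \<alpha> \<in> iso (G Mod Z) (H Mod W) \<and>
    \<beta> \<in> iso (G\<lparr>carrier := q_derived q G\<rparr>) (H\<lparr>carrier := q_derived q H\<rparr>) \<and>
    (\<forall>a1\<in>carrier G. \<forall>b1\<in>carrier G. \<forall>a2\<in>carrier H. \<forall>b2\<in>carrier H.
      \<alpha> (Z #>\<^bsub>G\<^esub> a1) = W #>\<^bsub>H\<^esub> a2 \<and> \<alpha> (Z #>\<^bsub>G\<^esub> b1) = W #>\<^bsub>H\<^esub> b2 \<longrightarrow>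
        \<beta> (commutator G a1 b1) = commutator H a2 b2 \<and>
        \<beta> (a1 [^]\<^bsub>G\<^esub> q) = a2 [^]\<^bsub>H\<^esub> q)"

lemma isoclinic_mod_iff: "isoclinic_mod q G Z H W \<longleftrightarrow> (\<exists>\<alpha> \<beta>. isoclinism q G Z H W \<alpha> \<beta>)"
  by (simp add: isoclinic_mod_def isoclinism_def)

context group begin

lemma q_derived_subgroup: "subgroup (q_derived q G) G"
  unfolding q_derived_def by (rule generate_is_subgroup) auto

lemma q_derived_gens:
  "g \<in> carrier G \<Longrightarrow> g [^] q \<in> q_derived q G"
  "g \<in> carrier G \<Longrightarrow> h \<in> carrier G \<Longrightarrow> commutator G g h \<in> q_derived q G"
  unfolding q_derived_def by (auto intro!: generate.incl)

end

lemma FactGroup_coset: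
  "A \<in> carrier (G Mod N) \<longleftrightarrow> (\<exists>g\<in>carrier G. A = N #>\<^bsub>G\<^esub> g)"
  by (auto simp: FactGroup_def RCOSETS_def)

lemma isoclinism_sym:
  assumes G: "group G" and H: "group H" and Z: "Z \<lhd> G" and W: "W \<lhd> H"
    and iso: "isoclinism q G Z H W \<alpha> \<beta>"
  shows "isoclinism q H W G Z (inv_into (carrier (G Mod Z)) \<alpha>) (inv_into (q_derived q G) \<beta>)"
proof -
  let ?A = "inv_into (carrier (G Mod Z)) \<alpha>" and ?B = "inv_into (q_derived q G) \<beta>"
  interpret G: group G by fact
  interpret H: group H by fact
  interpret Z: normal Z G by fact
  interpret W: normal W H by fact
  have \<alpha>: "\<alpha> \<in> iso (G Mod Z) (H Mod W)"
    and \<beta>: "\<beta> \<in> iso (G\<lparr>carrier := q_derived q G\<rparr>) (H\<lparr>carrier := q_derived q H\<rparr>)"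
    using iso by (simp_all add: isoclinism_def)
  have inj: "inj_on \<beta> (q_derived q G)" using \<beta> by (simp add: iso_def bij_betw_def)
  have A_iso: "?A \<in> iso (H Mod W) (G Mod Z)"
    using group.iso_set_sym[OF Z.factorgroup_is_group \<alpha>] .
  have B_iso: "?B \<in> iso (H\<lparr>carrier := q_derived q H\<rparr>) (G\<lparr>carrier := q_derived q G\<rparr>)"
    using group.iso_set_sym[OF G.subgroup_imp_group[OF G.q_derived_subgroup] \<beta>] by simp
  have \<alpha>_inv: "\<alpha> (Z #>\<^bsub>G\<^esub> b) = W #>\<^bsub>H\<^esub> a"
    if "a \<in> carrier H" "b \<in> carrier G" "?A (W #>\<^bsub>H\<^esub> a) = Z #>\<^bsub>G\<^esub> b" for a b
  proof -
    have "W #>\<^bsub>H\<^esub> a \<in> \<alpha> ` carrier (G Mod Z)"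
      using \<alpha> that by (auto simp: iso_def bij_betw_def FactGroup_coset)
    from f_inv_into_f[OF this] show ?thesis by (simp only: that(3))
  qed
  have "?B (commutator H a1 b1) = commutator G a2 b2 \<and> ?B (a1 [^]\<^bsub>H\<^esub> q) = a2 [^]\<^bsub>G\<^esub> q"
    if "a1 \<in> carrier H" "b1 \<in> carrier H" "a2 \<in> carrier G" "b2 \<in> carrier G"
      "?A (W #>\<^bsub>H\<^esub> a1) = Z #>\<^bsub>G\<^esub> a2" "?A (W #>\<^bsub>H\<^esub> b1) = Z #>\<^bsub>G\<^esub> b2" for a1 b1 a2 b2
  proof -
    have "\<alpha> (Z #>\<^bsub>G\<^esub> a2) = W #>\<^bsub>H\<^esub> a1" "\<alpha> (Z #>\<^bsub>G\<^esub> b2) = W #>\<^bsub>H\<^esub> b1"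
      using \<alpha>_inv that by blast+
    then have "\<beta> (commutator G a2 b2) = commutator H a1 b1 \<and> \<beta> (a2 [^]\<^bsub>G\<^esub> q) = a1 [^]\<^bsub>H\<^esub> q"
      using iso that unfolding isoclinism_def by blast
    moreover have "?B (\<beta> (commutator G a2 b2)) = commutator G a2 b2"
      "?B (\<beta> (a2 [^]\<^bsub>G\<^esub> q)) = a2 [^]\<^bsub>G\<^esub> q"
      by (rule inv_into_f_f[OF inj], rule G.q_derived_gens, fact+)+
    ultimately show ?thesis by simp
  qed
  then show ?thesis unfolding isoclinism_def using A_iso B_iso by blast
qed

text \<open>The sets \<open>D\<close> for which \<open>bog_kernel\<close> is \<open>M\<^sub>0\<^sup>q(G)\<close> (flag \<open>False\<close>) and its hatted
  version (flag \<open>True\<close>); the flag lets the two statements share one proof.\<close>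
definition torsion_part :: "bool \<Rightarrow> nat \<Rightarrow> ('a, 'b) monoid_scheme \<Rightarrow> 'a set" where
  "torsion_part hat q G = {g \<in> carrier G. hat \<and> g [^]\<^bsub>G\<^esub> q = \<one>\<^bsub>G\<^esub>}"

locale isoclinic_pair =
  G: central_group q G "torsion_part hat q G" Z + H: central_group q H "torsion_part hat q H" W
  for q hat and G :: "('a, 'c) monoid_scheme" and Z and H :: "('b, 'd) monoid_scheme" and W +
  fixes \<alpha> \<beta>
  assumes isoclinism: "isoclinism q G Z H W \<alpha> \<beta>"
begin

abbreviation "BG \<equiv> bog_multiplier q G (torsion_part hat q G)"
abbreviation "BH \<equiv> bog_multiplier q H (torsion_part hat q H)"

text \<open>Representatives \<open>\<sigma> g\<close> of the cosets \<open>\<alpha> (g Z)\<close>; they need not form a homomorphism.\<close>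
lemma isoclinism_lift:
  obtains \<sigma> where "\<And>g. g \<in> carrier G \<Longrightarrow> \<sigma> g \<in> carrier H"
    "\<And>g. g \<in> carrier G \<Longrightarrow> \<alpha> (Z #>\<^bsub>G\<^esub> g) = W #>\<^bsub>H\<^esub> \<sigma> g"
proof -
  have "\<exists>h. h \<in> carrier H \<and> \<alpha> (Z #>\<^bsub>G\<^esub> g) = W #>\<^bsub>H\<^esub> h" if "g \<in> carrier G" for g
  proof -
    have "Z #>\<^bsub>G\<^esub> g \<in> carrier (G Mod Z)" using that by (auto simp: FactGroup_coset)
    then have "\<alpha> (Z #>\<^bsub>G\<^esub> g) \<in> carrier (H Mod W)"
      using isoclinism by (auto simp: isoclinism_def iso_def hom_def)
    then show ?thesis by (auto simp: FactGroup_coset)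
  qed
  then show thesis using that by metis
qed

context
  fixes \<sigma>
  assumes \<sigma>: "\<And>g. g \<in> carrier G \<Longrightarrow> \<sigma> g \<in> carrier H"
    and lift: "\<And>g. g \<in> carrier G \<Longrightarrow> \<alpha> (Z #>\<^bsub>G\<^esub> g) = W #>\<^bsub>H\<^esub> \<sigma> g"
begin

lemma \<beta>_commutator:
  "a \<in> carrier G \<Longrightarrow> b \<in> carrier G \<Longrightarrow> \<beta> (commutator G a b) = commutator H (\<sigma> a) (\<sigma> b)"
  and \<beta>_pow: "a \<in> carrier G \<Longrightarrow> \<beta> (a [^]\<^bsub>G\<^esub> q) = \<sigma> a [^]\<^bsub>H\<^esub> q"
  using isoclinism \<sigma> lift unfolding isoclinism_def by blast+

text \<open>The isomorphism \<open>\<beta>\<close> is compatible with \<open>\<eta>\<close>. It is this that makes renaming preserve the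
  kernel of \<open>\<eta>\<close>, the q-Schur multiplier.\<close>
lemma \<beta>_eta:
  assumes "w \<in> words (qgens q G)"
  shows "word_val G (eta_gen q G) w \<in> q_derived q G"
    and "\<beta> (word_val G (eta_gen q G) w) = word_val H (eta_gen q H) (rename \<sigma> w)"
proof -
  let ?G = "G\<lparr>carrier := q_derived q G\<rparr>" and ?H = "H\<lparr>carrier := q_derived q H\<rparr>"
  interpret S: subgroup "q_derived q G" G by (rule G.q_derived_subgroup)
  interpret \<beta>: group_hom ?G ?H \<beta>
    using isoclinism G.subgroup_imp_group[OF G.q_derived_subgroup]
      H.subgroup_imp_group[OF H.q_derived_subgroup]
    by (simp add: group_hom_def group_hom_axioms_def isoclinism_def iso_def)
  have inv: "\<beta> (inv\<^bsub>G\<^esub> x) = inv\<^bsub>H\<^esub> (\<beta> x)" if "x \<in> q_derived q G" for x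
    using \<beta>.hom_inv[of x] that \<beta>.hom_closed[of x]
      G.m_inv_consistent[OF G.q_derived_subgroup] H.m_inv_consistent[OF H.q_derived_subgroup]
    by simp
  have mult: "\<beta> (x \<otimes>\<^bsub>G\<^esub> y) = \<beta> x \<otimes>\<^bsub>H\<^esub> \<beta> y" if "x \<in> q_derived q G" "y \<in> q_derived q G" for x y
    using \<beta>.hom_mult[of x y] that by simp
  have "word_val G (eta_gen q G) w \<in> q_derived q G \<and>
    \<beta> (word_val G (eta_gen q G) w) = word_val H (eta_gen q H) (rename \<sigma> w)"
    using assms
  proof (induction w)
    case Nil
    then show ?case using \<beta>.hom_one by (simp add: rename_def)
  next
    case (Cons p w)
    obtain x b where p: "p = (x, b)" by (cases p)
    have x: "x \<in> qgens q G" using Cons.prems p by simp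
    then have "eta_gen q G x \<in> q_derived q G"
      by (auto simp: qgens_def G.q_derived_gens split: if_splits)
    moreover have "\<beta> (eta_gen q G x) = eta_gen q H (map_qgen \<sigma> x)"
      using x by (auto simp: qgens_def \<beta>_commutator \<beta>_pow split: if_splits)
    ultimately show ?case using Cons p by (simp add: rename_def mult inv)
  qed
  then show "word_val G (eta_gen q G) w \<in> q_derived q G"
    "\<beta> (word_val G (eta_gen q G) w) = word_val H (eta_gen q H) (rename \<sigma> w)" by auto
qed

lemma \<beta>_one: "\<beta> \<one>\<^bsub>G\<^esub> = \<one>\<^bsub>H\<^esub>"
  using \<beta>_eta(2)[of "[]"] by (simp add: rename_def)

lemma bog_multiplier_hom:
  obtains \<Phi> where "\<Phi> \<in> hom BG BH"
    "\<And>w. w \<in> words (qgens q G) \<Longrightarrow> \<Phi> (bog_elt q G (torsion_part hat q G) w) =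
      bog_elt q H (torsion_part hat q H) (rename \<sigma> w)"
proof
  let ?g = "bog_elt q G (torsion_part hat q G)" and ?h = "bog_elt q H (torsion_part hat q H)"
  define \<Phi> where "\<Phi> c = ?h (rename \<sigma> (SOME w. w \<in> words (qgens q G) \<and> c = ?g w))" for c
  have cong: "?h (rename \<sigma> u) = ?h (rename \<sigma> v)"
    if "u \<in> words (qgens q G)" "v \<in> words (qgens q G)" "?g u = ?g v" for u v
  proof (rule rename_bog_elt_cong[OF G.central_group_axioms H.central_group_axioms])
    show "\<sigma> g \<in> carrier H" "\<alpha> (Z #>\<^bsub>G\<^esub> g) = W #>\<^bsub>H\<^esub> \<sigma> g" if "g \<in> carrier G" for g
      using that by (rule \<sigma>, rule lift)
    show "\<alpha> \<in> hom (G Mod Z) (H Mod W)" using isoclinism by (simp add: isoclinism_def iso_def)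
    show "commutator H (\<sigma> x) (\<sigma> y) = \<one>\<^bsub>H\<^esub>"
      if "x \<in> carrier G" "y \<in> carrier G" "commutator G x y = \<one>\<^bsub>G\<^esub>" for x y
      using \<beta>_commutator[OF that(1,2)] that \<beta>_one by simp
    show "\<sigma> g \<in> torsion_part hat q H" if "g \<in> torsion_part hat q G" for g
      using \<beta>_pow[of g] that \<beta>_one \<sigma> by (simp add: torsion_part_def)
  qed (use that in simp_all)
  show \<Phi>: "\<Phi> (?g w) = ?h (rename \<sigma> w)" if w: "w \<in> words (qgens q G)" for w
  proof -
    have "\<exists>v. v \<in> words (qgens q G) \<and> ?g w = ?g v" using w by blast
    from someI_ex[OF this] show ?thesis unfolding \<Phi>_def by (intro cong) (simp_all add: w)
  qed
  have r: "rename \<sigma> w \<in> words (qgens q H)" if "w \<in> words (qgens q G)" for w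
    using rename_words[OF _ that, of \<sigma> H] \<sigma> by blast
  show "\<Phi> \<in> hom BG BH"
  proof (rule homI)
    show "\<Phi> x \<in> carrier BH" if "x \<in> carrier BG" for x
    proof -
      obtain w where "w \<in> words (qgens q G)" "word_val G (eta_gen q G) w = \<one>\<^bsub>G\<^esub>" "x = ?g w"
        using \<open>x \<in> carrier BG\<close> by (auto simp: G.bog_multiplier_carrier)
      then show ?thesis
        using \<beta>_eta(2)[of w] \<beta>_one r by (auto simp: H.bog_multiplier_carrier \<Phi>)
    qed
    show "\<Phi> (x \<otimes>\<^bsub>BG\<^esub> y) = \<Phi> x \<otimes>\<^bsub>BH\<^esub> \<Phi> y" if "x \<in> carrier BG" "y \<in> carrier BG" for x y
      using that
      by (auto simp: G.bog_multiplier_carrier G.bog_multiplier_mult H.bog_multiplier_mult \<Phi> r rename_append)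
  qed
qed

end

end

text \<open>Applied to \<open>\<rho> = \<tau> \<circ> \<sigma>\<close>, where \<open>\<tau>\<close> and \<open>\<sigma>\<close> represent mutually inverse isomorphisms of
  central quotients, this shows that renaming back and forth is the identity on classes.\<close>
lemma (in central_group) bog_elt_rename_central:
  assumes w: "w \<in> words (qgens q G)"
    and \<rho>: "\<And>g. g \<in> carrier G \<Longrightarrow> \<rho> g \<in> carrier G" "\<And>g. g \<in> carrier G \<Longrightarrow> Z #> \<rho> g = Z #> g"
  shows "bog_elt q G D (rename \<rho> w) = bog_elt q G D w"
proof -
  let ?f = "\<lambda>x. bog_elt q G D [(x, True)]" and ?K = "bog_square q G D"
  have "bog_elt q G D (rename \<rho> w) = word_val ?K (?f \<circ> map_qgen \<rho>) w"
    using word_val_bog_elt[OF rename_words[OF _ w, of \<rho> G]] \<rho> by (simp add: word_val_rename)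
  also have "\<dots> = word_val ?K ?f w"
  proof (rule word_val_cong[OF w])
    fix x assume "x \<in> qgens q G"
    then consider g h where "x = Tens g h" "g \<in> carrier G" "h \<in> carrier G"
      | g where "x = Diag g" "q > 0" "g \<in> carrier G"
      by (auto simp: qgens_def split: if_splits)
    then show "(?f \<circ> map_qgen \<rho>) x = ?f x"
    proof cases
      case 1
      then show ?thesis using bog_elt_tens_cong[of "\<rho> g" g "\<rho> h" h] \<rho> by simp
    next
      case 2
      then show ?thesis using bog_elt_diag_cong[of "\<rho> g" g] \<rho> by simp
    qed
  qed
  finally show ?thesis using word_val_bog_elt[OF w] by simp
qed

lemma (in isoclinic_pair) bog_multiplier_iso: "BG \<cong> BH"
proof -
  let ?\<alpha>' = "inv_into (carrier (G Mod Z)) \<alpha>"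
  let ?g = "bog_elt q G (torsion_part hat q G)" and ?h = "bog_elt q H (torsion_part hat q H)"
  have "isoclinism q H W G Z ?\<alpha>' (inv_into (q_derived q G) \<beta>)"
    by (rule isoclinism_sym[OF G.group_axioms H.group_axioms G.Z.normal_axioms H.Z.normal_axioms isoclinism])
  then interpret inv: isoclinic_pair q hat H W G Z ?\<alpha>' "inv_into (q_derived q G) \<beta>"
    by unfold_locales
  obtain \<sigma> where \<sigma>: "\<And>g. g \<in> carrier G \<Longrightarrow> \<sigma> g \<in> carrier H"
    "\<And>g. g \<in> carrier G \<Longrightarrow> \<alpha> (Z #>\<^bsub>G\<^esub> g) = W #>\<^bsub>H\<^esub> \<sigma> g" using isoclinism_lift by blast
  obtain \<tau> where \<tau>: "\<And>h. h \<in> carrier H \<Longrightarrow> \<tau> h \<in> carrier G"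
    "\<And>h. h \<in> carrier H \<Longrightarrow> ?\<alpha>' (W #>\<^bsub>H\<^esub> h) = Z #>\<^bsub>G\<^esub> \<tau> h" using inv.isoclinism_lift by blast
  obtain \<Phi> where \<Phi>: "\<Phi> \<in> hom BG BH"
    "\<And>w. w \<in> words (qgens q G) \<Longrightarrow> \<Phi> (?g w) = ?h (rename \<sigma> w)" using bog_multiplier_hom[OF \<sigma>] by blast
  obtain \<Psi> where \<Psi>: "\<Psi> \<in> hom BH BG"
    "\<And>w. w \<in> words (qgens q H) \<Longrightarrow> \<Psi> (?h w) = ?g (rename \<tau> w)" using inv.bog_multiplier_hom[OF \<tau>] by blast
  have \<alpha>: "bij_betw \<alpha> (carrier (G Mod Z)) (carrier (H Mod W))"
    using isoclinism by (simp add: isoclinism_def iso_def)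
  have \<tau>\<sigma>: "Z #>\<^bsub>G\<^esub> \<tau> (\<sigma> g) = Z #>\<^bsub>G\<^esub> g" if "g \<in> carrier G" for g
  proof -
    have "Z #>\<^bsub>G\<^esub> \<tau> (\<sigma> g) = ?\<alpha>' (\<alpha> (Z #>\<^bsub>G\<^esub> g))" using that by (simp add: \<sigma> flip: \<tau>(2))
    also have "\<dots> = Z #>\<^bsub>G\<^esub> g"
      using bij_betw_inv_into_left[OF \<alpha>] that by (auto simp: FactGroup_coset)
    finally show ?thesis .
  qed
  have \<sigma>\<tau>: "W #>\<^bsub>H\<^esub> \<sigma> (\<tau> h) = W #>\<^bsub>H\<^esub> h" if "h \<in> carrier H" for h
  proof -
    have "W #>\<^bsub>H\<^esub> \<sigma> (\<tau> h) = \<alpha> (?\<alpha>' (W #>\<^bsub>H\<^esub> h))" using that by (simp add: \<tau> flip: \<sigma>(2))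
    also have "\<dots> = W #>\<^bsub>H\<^esub> h"
      using bij_betw_inv_into_right[OF \<alpha>] that by (auto simp: FactGroup_coset)
    finally show ?thesis .
  qed
  have "bij_betw \<Phi> (carrier BG) (carrier BH)"
  proof (rule bij_betw_byWitness[where f' = \<Psi>])
    show "\<Phi> ` carrier BG \<subseteq> carrier BH" "\<Psi> ` carrier BH \<subseteq> carrier BG"
      using \<Phi>(1) \<Psi>(1) by (auto simp: hom_def)
    have "\<Psi> (\<Phi> (?g w)) = ?g w" if w: "w \<in> words (qgens q G)" for w
    proof -
      have "rename \<sigma> w \<in> words (qgens q H)" using rename_words[OF _ w, of \<sigma> H] \<sigma> by blast
      then show ?thesis
        using w by (simp add: \<Phi> \<Psi> rename_comp G.bog_elt_rename_central \<sigma> \<tau> \<tau>\<sigma>)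
    qed
    then show "\<forall>c\<in>carrier BG. \<Psi> (\<Phi> c) = c" by (auto simp: G.bog_multiplier_carrier)
    have "\<Phi> (\<Psi> (?h w)) = ?h w" if w: "w \<in> words (qgens q H)" for w
    proof -
      have "rename \<tau> w \<in> words (qgens q G)" using rename_words[OF _ w, of \<tau> G] \<tau> by blast
      then show ?thesis
        using w by (simp add: \<Phi> \<Psi> rename_comp H.bog_elt_rename_central \<sigma> \<tau> \<sigma>\<tau>)
    qed
    then show "\<forall>c\<in>carrier BH. \<Phi> (\<Psi> c) = c" by (auto simp: H.bog_multiplier_carrier)
  qed
  then show ?thesis using \<Phi>(1) by (auto simp: is_iso_def iso_def)
qed

section \<open>The subgroups \<open>Z\<^sub>q\<close> and the two multipliers\<close>

lemma bog_kernel_M0: "bog_kernel q G (torsion_part False q G) = M0 q G"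
  by (simp add: bog_kernel_def M0_def torsion_part_def)

lemma bog_kernel_M0_hat: "bog_kernel q G (torsion_part True q G) = M0_hat q G"
  by (simp add: bog_kernel_def M0_hat_def torsion_part_def setcompr_eq_image)

lemma torsion_group_part: "group G \<Longrightarrow> torsion_group q G (torsion_part hat q G)"
  by (auto simp: torsion_group_def torsion_group_axioms_def torsion_part_def)

text \<open>On the center the class of \<open>{(z,z)}\<close> is multiplicative by \<open>diag_mult_center\<close>, and \<open>Z\<^sub>q(G)\<close> is
  the kernel of the resulting homomorphism.\<close>
lemma central_group_Zq:
  assumes "group G"
  shows "central_group q G (torsion_part False q G) (Zq q G)"
proof -
  interpret torsion_group q G "torsion_part False q G" by (rule torsion_group_part[OF assms])
  let ?K = "bog_square q G (torsion_part False q G)" and ?d = "\<lambda>g. bog_elt q G (torsion_part False q G) (diag g)"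
  interpret q_pairing q G ?K "\<lambda>x. bog_elt q G (torsion_part False q G) [(x, True)]" by (rule bog_pairing)
  interpret C: subgroup "center G" G by (rule center_subgroup)
  have Zq: "z \<in> Zq q G \<longleftrightarrow> z \<in> center G \<and> (q > 0 \<longrightarrow> ?d z = \<one>\<^bsub>?K\<^esub>)" for z
  proof (cases "z \<in> center G \<and> q > 0")
    case True
    then have "?d z = \<one>\<^bsub>?K\<^esub> \<longleftrightarrow> ext_diag q G z \<in> M0 q G"
      using bog_elt_eq_one_iff[OF tens_in_words(2)[OF C.mem_carrier]] 
      unfolding ext_diag_def bog_kernel_M0 by blast
    then show ?thesis using True by (simp add: Zq_def)
  qed (auto simp: Zq_def)
  have mult: "?d (x \<otimes>\<^bsub>G\<^esub> z) = ?d x \<otimes>\<^bsub>?K\<^esub> ?d z" if "q > 0" "x \<in> center G" "z \<in> center G" for x z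
    by (rule diag_mult_center[OF _ that(1) C.mem_carrier[OF that(2)] that(3)]) (rule bog_elt_commuting)
  have one: "?d \<one>\<^bsub>G\<^esub> = \<one>\<^bsub>?K\<^esub>" if "q > 0"
    using mult[OF that, of "\<one>\<^bsub>G\<^esub>" "\<one>\<^bsub>G\<^esub>"] that diag_closed[OF that, of "\<one>\<^bsub>G\<^esub>"] by simp
  have "subgroup (Zq q G) G"
  proof (rule subgroupI)
    show "Zq q G \<subseteq> carrier G" by (auto simp: Zq)
    have "\<one>\<^bsub>G\<^esub> \<in> Zq q G" using one C.one_closed by (simp add: Zq)
    then show "Zq q G \<noteq> {}" by blast
    show "x \<otimes>\<^bsub>G\<^esub> z \<in> Zq q G" if "x \<in> Zq q G" "z \<in> Zq q G" for x z
      using that mult[of x z] by (auto simp: Zq)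
    show "inv\<^bsub>G\<^esub> z \<in> Zq q G" if "z \<in> Zq q G" for z
      using that mult[of z "inv\<^bsub>G\<^esub> z"] one diag_closed[of "inv\<^bsub>G\<^esub> z"] by (auto simp: Zq)
  qed
  then show ?thesis
    by (rule central_group.intro[OF torsion_group_axioms central_group_axioms.intro])
      (auto simp: Zq_def bog_kernel_M0)
qed

lemma central_group_Zq_hat:
  assumes "group G"
  shows "central_group q G (torsion_part True q G) (Zq_hat q G)"
proof -
  interpret torsion_group q G "torsion_part True q G" by (rule torsion_group_part[OF assms])
  interpret C: subgroup "center G" G by (rule center_subgroup)
  have "subgroup (Zq_hat q G) G"
  proof (rule subgroupI)
    show "Zq_hat q G \<subseteq> carrier G" by (auto simp: Zq_hat_def)
    have "\<one>\<^bsub>G\<^esub> \<in> Zq_hat q G" using C.one_closed by (simp add: Zq_hat_def)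
    then show "Zq_hat q G \<noteq> {}" by blast
    show "x \<otimes>\<^bsub>G\<^esub> z \<in> Zq_hat q G" if "x \<in> Zq_hat q G" "z \<in> Zq_hat q G" for x z
    proof -
      have xz: "x \<in> center G" "z \<in> center G" "x [^]\<^bsub>G\<^esub> q = \<one>\<^bsub>G\<^esub>" "z [^]\<^bsub>G\<^esub> q = \<one>\<^bsub>G\<^esub>"
        using that by (simp_all add: Zq_hat_def)
      then have "x \<otimes>\<^bsub>G\<^esub> z = z \<otimes>\<^bsub>G\<^esub> x" unfolding center_def by blast
      from pow_mult_distrib[OF this, of q] have "(x \<otimes>\<^bsub>G\<^esub> z) [^]\<^bsub>G\<^esub> q = \<one>\<^bsub>G\<^esub>"
        using xz by simp
      then show ?thesis using xz by (simp add: Zq_hat_def)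
    qed
    show "inv\<^bsub>G\<^esub> z \<in> Zq_hat q G" if "z \<in> Zq_hat q G" for z
      using that nat_pow_inv[of z q] by (auto simp: Zq_hat_def)
  qed
  then show ?thesis
    by (rule central_group.intro[OF torsion_group_axioms central_group_axioms.intro])
      (auto simp: Zq_hat_def torsion_part_def bog_kernel_def intro!: generate.incl)
qed

theorem theorem4p3:
  fixes q :: nat
    and G :: "('a, 'c) monoid_scheme"
    and H :: "('b, 'd) monoid_scheme"
  assumes "group G" and "group H"
  shows "(q_isoclinic q G H \<longrightarrow> B0 q G \<cong> B0 q H) \<and>
         (q_hat_isoclinic q G H \<longrightarrow> B0_hat q G \<cong> B0_hat q H)"
proof (intro conjI impI)
  assume "q_isoclinic q G H"
  then obtain \<alpha> \<beta> where "isoclinism q G (Zq q G) H (Zq q H) \<alpha> \<beta>"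
    by (auto simp: q_isoclinic_def isoclinic_mod_iff)
  then interpret isoclinic_pair q False G "Zq q G" H "Zq q H" \<alpha> \<beta>
    using assms by (intro isoclinic_pair.intro isoclinic_pair_axioms.intro central_group_Zq)
  show "B0 q G \<cong> B0 q H"
    using bog_multiplier_iso by (simp add: bog_multiplier_def B0_def bog_kernel_M0)
next
  assume "q_hat_isoclinic q G H"
  then obtain \<alpha> \<beta> where "isoclinism q G (Zq_hat q G) H (Zq_hat q H) \<alpha> \<beta>"
    by (auto simp: q_hat_isoclinic_def isoclinic_mod_iff)
  then interpret isoclinic_pair q True G "Zq_hat q G" H "Zq_hat q H" \<alpha> \<beta>
    using assms by (intro isoclinic_pair.intro isoclinic_pair_axioms.intro central_group_Zq_hat)
  show "B0_hat q G \<cong> B0_hat q H"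
    using bog_multiplier_iso by (simp add: bog_multiplier_def B0_hat_def bog_kernel_M0_hat)
qed

end
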